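(* Let $\mathcal H=\bigoplus_{\mathbf n\in\mathbb N^\ell}\mathcal H_{\mathbf n}$ be an $\mathbb N^\ell$-graded connected Hopf algebra over $\mathbb Q$ with finite-dimensional homogeneous components, let $\phi,\psi:\mathcal H\to\mathbb Q$ be characters, and let $\mathbf k\in(\mathbb N\cup\{\infty\})^\ell$. Then: (a) $\mathcal S_{\mathbf k}(\phi,\psi)=\mathcal I^{\mathbf k}(\phi,\psi)^{\perp}$, where $\mathcal I^{\mathbf k}(\phi,\psi)^{\perp}=\{h\in\mathcal H: f(h)=0\text{ for all }f\in\mathcal I^{\mathbf k}(\phi,\psi)\}$; (b) $\mathcal I^{\mathbf k}(\phi,\psi)$ is a graded Hopf ideal of $\mathcal H^*$; (c) $\mathcal S_{\mathbf k}(\phi,\psi)$ is a graded Hopf subalgebra of $\mathcal H$.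
   Context: $\mathbb N^\ell$ is partially ordered coordinatewise, and this is extended to $(\mathbb N\cup\{\infty\})^\ell$ with $\infty$ larger than every natural number; in direct sums $\bigoplus_{\mathbf n\le\mathbf k}$ the index $\mathbf n$ ranges over $\mathbb N^\ell$. Connected means $\mathcal H_{\mathbf 0}=\mathbb Q\cdot1$. A character is a multiplicative linear functional with value $1$ at $1$. $\mathcal H^*=\bigoplus_{\mathbf n}(\mathcal H_{\mathbf n})^*$ is the graded dual Hopf algebra (product = convolution dual to the coproduct of $\mathcal H$, coproduct dual to the product). For a linear functional $\phi$, $\phi_{\mathbf n}\in(\mathcal H_{\mathbf n})^*$ denotes the restriction of $\phi$ to $\mathcal H_{\mathbf n}$. $\mathcal S_{\mathbf k}(\phi,\psi)$ is the largest $\mathbb N^\ell$-graded subcoalgebra $C$ of $\mathcal H$ such that $\phi(h)=\psi(h)$ for all $h\in C\cap\bigoplus_{\mathbf n\le\mathbf k}\mathcal H_{\mathbf n}$. $\mathcal I^{\mathbf k}(\phi,\psi)$ is the ideal of $\mathcal H^*$ generated by the elements $\phi_{\mathbf n}-\psi_{\mathbf n}$, $\mathbf n\in\mathbb N^\ell$, $\mathbf n\le\mathbf k$. *)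

theory Defs
  imports Complex_Main "HOL-Library.Poly_Mapping" "HOL-Library.Function_Algebras"
    "HOL-Library.Extended_Nat"
begin

section \<open>Vector spaces and algebras over the rationals\<close>

class rat_vector = ab_group_add +
  fixes scaleQ :: "rat \<Rightarrow> 'a \<Rightarrow> 'a"  (infixr \<open>*\<^sub>Q\<close> 75)
  assumes scaleQ_add_right: "a *\<^sub>Q (x + y) = a *\<^sub>Q x + a *\<^sub>Q y"
    and scaleQ_add_left: "(a + b) *\<^sub>Q x = a *\<^sub>Q x + b *\<^sub>Q x"
    and scaleQ_scaleQ: "a *\<^sub>Q b *\<^sub>Q x = (a * b) *\<^sub>Q x"
    and scaleQ_one: "1 *\<^sub>Q x = x"

class rat_algebra_1 = rat_vector + ring_1 +
  assumes mult_scaleQ_left: "a *\<^sub>Q x * y = a *\<^sub>Q (x * y)"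
    and mult_scaleQ_right: "x * a *\<^sub>Q y = a *\<^sub>Q (x * y)"

global_interpretation qvs: vector_space "scaleQ :: rat \<Rightarrow> 'a \<Rightarrow> 'a::rat_vector"
  by unfold_locales (rule scaleQ_add_right scaleQ_add_left scaleQ_scaleQ scaleQ_one)+

abbreviation qlinear :: "('a::rat_vector \<Rightarrow> 'b::rat_vector) \<Rightarrow> bool" where
  "qlinear \<equiv> Vector_Spaces.linear scaleQ scaleQ"

lemma qlinear_iff:
  "qlinear f \<longleftrightarrow> (\<forall>x y. f (x + y) = f x + f y) \<and> (\<forall>c x. f (c *\<^sub>Q x) = c *\<^sub>Q f x)"
  unfolding Vector_Spaces.linear_def module_hom_def module_hom_axioms_def
  by (auto simp: qvs.vector_space_axioms qvs.module_axioms)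

definition qbilinear :: "('a::rat_vector \<Rightarrow> 'b::rat_vector \<Rightarrow> 'c::rat_vector) \<Rightarrow> bool" where
  "qbilinear B \<longleftrightarrow> (\<forall>a. qlinear (B a)) \<and> (\<forall>b. qlinear (\<lambda>a. B a b))"

instantiation rat :: rat_algebra_1
begin
definition scaleQ_rat_def [simp]: "c *\<^sub>Q (x::rat) = c * x"
instance by standard (simp_all add: algebra_simps)
end

instantiation "fun" :: (type, rat_vector) rat_vector
begin
definition scaleQ_fun_def: "c *\<^sub>Q f = (\<lambda>x. c *\<^sub>Q f x)"
instance
  by standard
    (simp_all add: fun_eq_iff scaleQ_fun_def scaleQ_add_right scaleQ_add_left scaleQ_scaleQ scaleQ_one)
end

instantiation poly_mapping :: (type, rat_vector) rat_vector
begin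
definition scaleQ_poly_mapping_def: "c *\<^sub>Q p = Poly_Mapping.map (scaleQ c) p"
lemma lookup_scaleQ: "Poly_Mapping.lookup (c *\<^sub>Q p) k = c *\<^sub>Q Poly_Mapping.lookup p k"
  by (simp add: scaleQ_poly_mapping_def Poly_Mapping.map.rep_eq when_def)
instance
  by standard
    (auto intro!: poly_mapping_eqI simp: lookup_scaleQ lookup_add
       scaleQ_add_right scaleQ_add_left scaleQ_scaleQ scaleQ_one)
end

section \<open>Tensor products over the rationals\<close>

text \<open>The free rational vector space on pairs, modulo the bilinearity relations.\<close>

definition tensor_relators :: "(('a::rat_vector \<times> 'b::rat_vector) \<Rightarrow>\<^sub>0 rat) set" where
  "tensor_relators = qvs.span
     ({Poly_Mapping.single (a + a', b) 1 - Poly_Mapping.single (a, b) 1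
         - Poly_Mapping.single (a', b) 1 | a a' b. True} \<union>
      {Poly_Mapping.single (a, b + b') 1 - Poly_Mapping.single (a, b) 1
         - Poly_Mapping.single (a, b') 1 | a b b'. True} \<union>
      {Poly_Mapping.single (c *\<^sub>Q a, b) 1 - c *\<^sub>Q Poly_Mapping.single (a, b) 1 | a b c. True} \<union>
      {Poly_Mapping.single (a, c *\<^sub>Q b) 1 - c *\<^sub>Q Poly_Mapping.single (a, b) 1 | a b c. True})"

lemma subspace_tensor_relators: "qvs.subspace tensor_relators"
  by (simp add: tensor_relators_def)

quotient_type (overloaded) ('a, 'b) tensor =
  "('a::rat_vector \<times> 'b::rat_vector) \<Rightarrow>\<^sub>0 rat" / "\<lambda>x y. x - y \<in> tensor_relators"
proof (rule equivpI)
  show "reflp (\<lambda>x y. x - y \<in> (tensor_relators :: (('a \<times> 'b) \<Rightarrow>\<^sub>0 rat) set))"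
    by (simp add: reflp_def qvs.subspace_0 subspace_tensor_relators)
  show "symp (\<lambda>x y. x - y \<in> (tensor_relators :: (('a \<times> 'b) \<Rightarrow>\<^sub>0 rat) set))"
  proof (rule sympI)
    fix x y :: "('a \<times> 'b) \<Rightarrow>\<^sub>0 rat"
    assume "x - y \<in> tensor_relators"
    from qvs.subspace_neg[OF subspace_tensor_relators this]
    show "y - x \<in> tensor_relators" by simp
  qed
  show "transp (\<lambda>x y. x - y \<in> (tensor_relators :: (('a \<times> 'b) \<Rightarrow>\<^sub>0 rat) set))"
  proof (rule transpI)
    fix x y z :: "('a \<times> 'b) \<Rightarrow>\<^sub>0 rat"
    assume "x - y \<in> tensor_relators" "y - z \<in> tensor_relators"
    then have "(x - y) + (y - z) \<in> tensor_relators"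
      by (rule qvs.subspace_add[OF subspace_tensor_relators])
    then show "x - z \<in> tensor_relators" by simp
  qed
qed

instantiation tensor :: (rat_vector, rat_vector) rat_vector
begin

lift_definition zero_tensor :: "('a, 'b) tensor" is 0 .

lift_definition plus_tensor :: "('a, 'b) tensor \<Rightarrow> ('a, 'b) tensor \<Rightarrow> ('a, 'b) tensor" is "(+)"
proof -
  fix p q r s :: "('a \<times> 'b) \<Rightarrow>\<^sub>0 rat"
  assume "p - q \<in> tensor_relators" "r - s \<in> tensor_relators"
  from qvs.subspace_add[OF subspace_tensor_relators this]
  show "p + r - (q + s) \<in> tensor_relators" by (simp add: algebra_simps)
qed

lift_definition uminus_tensor :: "('a, 'b) tensor \<Rightarrow> ('a, 'b) tensor" is uminus
proof -
  fix p q :: "('a \<times> 'b) \<Rightarrow>\<^sub>0 rat"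
  assume "p - q \<in> tensor_relators"
  from qvs.subspace_neg[OF subspace_tensor_relators this]
  show "- p - - q \<in> tensor_relators" by (simp add: algebra_simps)
qed

lift_definition minus_tensor :: "('a, 'b) tensor \<Rightarrow> ('a, 'b) tensor \<Rightarrow> ('a, 'b) tensor" is "(-)"
proof -
  fix p q r s :: "('a \<times> 'b) \<Rightarrow>\<^sub>0 rat"
  assume "p - q \<in> tensor_relators" "r - s \<in> tensor_relators"
  from qvs.subspace_diff[OF subspace_tensor_relators this]
  show "p - r - (q - s) \<in> tensor_relators" by (simp add: algebra_simps)
qed

lift_definition scaleQ_tensor :: "rat \<Rightarrow> ('a, 'b) tensor \<Rightarrow> ('a, 'b) tensor" is scaleQ
proof -
  fix c and p q :: "('a \<times> 'b) \<Rightarrow>\<^sub>0 rat"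
  assume "p - q \<in> tensor_relators"
  from qvs.subspace_scale[OF subspace_tensor_relators this, of c]
  show "c *\<^sub>Q p - c *\<^sub>Q q \<in> tensor_relators" by (simp add: qvs.scale_right_diff_distrib)
qed

instance
proof
  fix a b c :: "('a, 'b) tensor" and r s :: rat
  note z = qvs.subspace_0[OF subspace_tensor_relators]
  show "a + b + c = a + (b + c)" by transfer (simp add: z algebra_simps)
  show "a + b = b + a" by transfer (simp add: z algebra_simps)
  show "0 + a = a" by transfer (simp add: z)
  show "- a + a = 0" by transfer (simp add: z)
  show "a - b = a + - b" by transfer (simp add: z)
  show "r *\<^sub>Q (a + b) = r *\<^sub>Q a + r *\<^sub>Q b" by transfer (simp add: z scaleQ_add_right)
  show "(r + s) *\<^sub>Q a = r *\<^sub>Q a + s *\<^sub>Q a" by transfer (simp add: z scaleQ_add_left)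
  show "r *\<^sub>Q s *\<^sub>Q a = (r * s) *\<^sub>Q a" by transfer (simp add: z)
  show "1 *\<^sub>Q a = a" by transfer (simp add: z)
qed

end

lift_definition tens :: "'a::rat_vector \<Rightarrow> 'b::rat_vector \<Rightarrow> ('a, 'b) tensor" (infixl \<open>\<otimes>\<close> 70)
  is "\<lambda>a b. Poly_Mapping.single (a, b) 1" .

definition formal_eval ::
  "('a::rat_vector \<Rightarrow> 'b::rat_vector \<Rightarrow> 'c::rat_vector) \<Rightarrow> (('a \<times> 'b) \<Rightarrow>\<^sub>0 rat) \<Rightarrow> 'c" where
  "formal_eval B p = (\<Sum>k\<in>Poly_Mapping.keys p. Poly_Mapping.lookup p k *\<^sub>Q B (fst k) (snd k))"

lemma formal_eval_superset:
  "finite K \<Longrightarrow> Poly_Mapping.keys p \<subseteq> K \<Longrightarrow>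
     formal_eval B p = (\<Sum>k\<in>K. Poly_Mapping.lookup p k *\<^sub>Q B (fst k) (snd k))"
  unfolding formal_eval_def by (rule sum.mono_neutral_left) (auto simp: in_keys_iff)

lemma formal_eval_add: "formal_eval B (p + q) = formal_eval B p + formal_eval B q"
proof -
  let ?K = "Poly_Mapping.keys p \<union> Poly_Mapping.keys q"
  have "Poly_Mapping.keys (p + q) \<subseteq> ?K" by (rule keys_add)
  then show ?thesis
    by (simp add: formal_eval_superset[of ?K] lookup_add scaleQ_add_left sum.distrib)
qed

lemma formal_eval_scaleQ: "formal_eval B (c *\<^sub>Q p) = c *\<^sub>Q formal_eval B p"
proof -
  have "Poly_Mapping.keys (c *\<^sub>Q p) \<subseteq> Poly_Mapping.keys p"
    by (auto simp: in_keys_iff lookup_scaleQ)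
  then show ?thesis
    by (simp add: formal_eval_superset[of "Poly_Mapping.keys p"] lookup_scaleQ
        qvs.scale_sum_right)
qed

lemma formal_eval_diff: "formal_eval B (p - q) = formal_eval B p - formal_eval B q"
  using formal_eval_add[of B "p - q" q] by (simp add: algebra_simps)

lemma formal_eval_single: "formal_eval B (Poly_Mapping.single (a, b) 1) = B a b"
  by (simp add: formal_eval_def)

lemma formal_eval_relators:
  assumes "qbilinear B" and "p \<in> tensor_relators"
  shows "formal_eval B p = 0"
proof -
  have *: "B (a + a') b = B a b + B a' b" "B a (b + b') = B a b + B a b'"
    "B (c *\<^sub>Q a) b = c *\<^sub>Q B a b" "B a (c *\<^sub>Q b) = c *\<^sub>Q B a b" for a a' b b' c
    using assms(1) by (auto simp: qbilinear_def qlinear_iff)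
  have "qvs.subspace {p. formal_eval B p = 0}"
    by (rule qvs.subspaceI)
      (auto simp: formal_eval_add formal_eval_scaleQ formal_eval_def[of B 0])
  then have "tensor_relators \<subseteq> {p. formal_eval B p = 0}"
    unfolding tensor_relators_def
    by (intro qvs.span_minimal)
      (auto simp: formal_eval_diff formal_eval_scaleQ formal_eval_single *)
  with assms(2) show ?thesis by auto
qed

text \<open>The linear map on the tensor product induced by a bilinear map; the value \<open>0\<close> for
  maps that are not bilinear is a dummy.\<close>

lift_definition tensor_lift ::
  "('a::rat_vector \<Rightarrow> 'b::rat_vector \<Rightarrow> 'c::rat_vector) \<Rightarrow> ('a, 'b) tensor \<Rightarrow> 'c"
  is "\<lambda>B p. if qbilinear B then formal_eval B p else 0"
proof -
  fix B :: "'a \<Rightarrow> 'b \<Rightarrow> 'c" and p q :: "('a \<times> 'b) \<Rightarrow>\<^sub>0 rat"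
  assume "p - q \<in> tensor_relators"
  then have "qbilinear B \<Longrightarrow> formal_eval B p - formal_eval B q = 0"
    using formal_eval_relators[of B "p - q"] by (simp add: formal_eval_diff)
  then show "(if qbilinear B then formal_eval B p else 0) =
      (if qbilinear B then formal_eval B q else 0)" by auto
qed

lemma tensor_lift_tens: "qbilinear B \<Longrightarrow> tensor_lift B (a \<otimes> b) = B a b"
  by transfer (simp add: formal_eval_single)

lemma qlinear_tensor_lift: "qlinear (tensor_lift B)"
proof -
  have "tensor_lift B (s + t) = tensor_lift B s + tensor_lift B t" for s t
    by transfer (simp add: formal_eval_add)
  moreover have "tensor_lift B (c *\<^sub>Q t) = c *\<^sub>Q tensor_lift B t" for c t
    by transfer (simp add: formal_eval_scaleQ)
  ultimately show ?thesis by (simp add: qlinear_iff)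
qed

definition tensor_map ::
  "('a::rat_vector \<Rightarrow> 'c::rat_vector) \<Rightarrow> ('b::rat_vector \<Rightarrow> 'd::rat_vector)
     \<Rightarrow> ('a, 'b) tensor \<Rightarrow> ('c, 'd) tensor" where
  "tensor_map f g = tensor_lift (\<lambda>a b. f a \<otimes> g b)"

definition tensor_assoc ::
  "(('a::rat_vector, 'b::rat_vector) tensor, 'c::rat_vector) tensor
     \<Rightarrow> ('a, ('b, 'c) tensor) tensor" where
  "tensor_assoc = tensor_lift (\<lambda>t c. tensor_lift (\<lambda>a b. a \<otimes> (b \<otimes> c)) t)"

definition tensor_mult ::
  "('a::rat_algebra_1, 'b::rat_algebra_1) tensor \<Rightarrow> ('a, 'b) tensor \<Rightarrow> ('a, 'b) tensor" where
  "tensor_mult s t = tensor_lift (\<lambda>a b. tensor_lift (\<lambda>c d. (a * c) \<otimes> (b * d)) t) s"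

text \<open>For subspaces \<open>V\<close>, \<open>W\<close> this is \<open>V \<otimes> W\<close>, viewed inside the
  tensor product of the ambient spaces.\<close>

definition tensor_span :: "'a::rat_vector set \<Rightarrow> 'b::rat_vector set \<Rightarrow> ('a, 'b) tensor set" where
  "tensor_span V W = qvs.span {a \<otimes> b | a b. a \<in> V \<and> b \<in> W}"

lemma qlinear_id: "qlinear (\<lambda>x. x)"
  by (simp add: qlinear_iff)

lemma qbilinear_iff:
  "qbilinear B \<longleftrightarrow>
     (\<forall>a b b'. B a (b + b') = B a b + B a b') \<and> (\<forall>c a b. B a (c *\<^sub>Q b) = c *\<^sub>Q B a b) \<and>
     (\<forall>a a' b. B (a + a') b = B a b + B a' b) \<and> (\<forall>c a b. B (c *\<^sub>Q a) b = c *\<^sub>Q B a b)"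
  by (auto simp: qbilinear_def qlinear_iff)

lemma tensor_relatorsI:
  "Poly_Mapping.single (a + a', b) 1
     - (Poly_Mapping.single (a, b) 1 + Poly_Mapping.single (a', b) 1) \<in> tensor_relators"
  "Poly_Mapping.single (a, b + b') 1
     - (Poly_Mapping.single (a, b) 1 + Poly_Mapping.single (a, b') 1) \<in> tensor_relators"
  "Poly_Mapping.single (c *\<^sub>Q a, b) 1 - c *\<^sub>Q Poly_Mapping.single (a, b) 1 \<in> tensor_relators"
  "Poly_Mapping.single (a, c *\<^sub>Q b) 1 - c *\<^sub>Q Poly_Mapping.single (a, b) 1 \<in> tensor_relators"
  unfolding tensor_relators_def diff_diff_add[symmetric]
     apply (rule qvs.span_base, rule UnI1, rule UnI1, rule UnI1, rule CollectI,
      (rule exI)+, rule conjI, rule refl, rule TrueI)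
    apply (rule qvs.span_base, rule UnI1, rule UnI1, rule UnI2, rule CollectI,
      (rule exI)+, rule conjI, rule refl, rule TrueI)
   apply (rule qvs.span_base, rule UnI1, rule UnI2, rule CollectI,
      (rule exI)+, rule conjI, rule refl, rule TrueI)
  apply (rule qvs.span_base, rule UnI2, rule CollectI,
      (rule exI)+, rule conjI, rule refl, rule TrueI)
  done

lemma qbilinear_tens: "qbilinear (\<otimes>)"
  unfolding qbilinear_iff by (intro conjI allI; transfer) (rule tensor_relatorsI)+

lemma tens_add_left: "(a + a') \<otimes> b = a \<otimes> b + a' \<otimes> b"
  and tens_add_right: "a \<otimes> (b + b') = a \<otimes> b + a \<otimes> b'"
  and tens_scaleQ_left: "(c *\<^sub>Q a) \<otimes> b = c *\<^sub>Q (a \<otimes> b)"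
  and tens_scaleQ_right: "a \<otimes> (c *\<^sub>Q b) = c *\<^sub>Q (a \<otimes> b)"
  for a a' :: "'a::rat_vector" and b b' :: "'b::rat_vector"
  using qbilinear_tens[where 'a='a and 'b='b] unfolding qbilinear_iff by auto

lemma tensor_induct [case_names tens add scaleQ]:
  assumes "\<And>a b. P (a \<otimes> b)" "\<And>s t. P s \<Longrightarrow> P t \<Longrightarrow> P (s + t)" "\<And>c t. P t \<Longrightarrow> P (c *\<^sub>Q t)"
  shows "P (t :: ('a::rat_vector, 'b::rat_vector) tensor)"
proof -
  have *: "P (abs_tensor p)" for p :: "('a \<times> 'b) \<Rightarrow>\<^sub>0 rat"
  proof (induction "card (Poly_Mapping.keys p)" arbitrary: p rule: less_induct)
    case less
    show ?case
    proof (cases "p = 0")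
      case True
      then have "abs_tensor p = 0 *\<^sub>Q (0 \<otimes> 0)" by (simp add: zero_tensor_def)
      then show ?thesis using assms(3)[OF assms(1), of 0 0 0] by simp
    next
      case False
      then obtain k where k: "k \<in> Poly_Mapping.keys p"
        by (metis keys_eq_empty all_not_in_conv)
      define c where "c = Poly_Mapping.lookup p k"
      define e where "e = (Poly_Mapping.single k 1 :: ('a \<times> 'b) \<Rightarrow>\<^sub>0 rat)"
      define q where "q = p - c *\<^sub>Q e"
      have "Poly_Mapping.keys q \<subseteq> Poly_Mapping.keys p - {k}"
        using k by (auto simp: in_keys_iff q_def e_def c_def lookup_minus lookup_scaleQ
            lookup_single when_def split: if_splits)
      then have "card (Poly_Mapping.keys q) < card (Poly_Mapping.keys p)"
        using k by (meson card_Diff1_less card_mono finite_Diff finite_keys le_less_trans)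
      then have q: "P (abs_tensor q)" by (rule less)
      have e: "abs_tensor e = fst k \<otimes> snd k" by (simp add: tens_def e_def)
      have "abs_tensor p = abs_tensor q + c *\<^sub>Q abs_tensor e"
        by (simp add: plus_tensor.abs_eq scaleQ_tensor.abs_eq q_def)
      then show ?thesis using assms(2)[OF q assms(3)[OF assms(1)]] e by simp
    qed
  qed
  show ?thesis using *[of "rep_tensor t"]
    by (simp add: Quotient3_abs_rep[OF Quotient3_tensor])
qed

lemma tensor_lift_add: "tensor_lift B (s + t) = tensor_lift B s + tensor_lift B t"
  and tensor_lift_scaleQ: "tensor_lift B (c *\<^sub>Q t) = c *\<^sub>Q tensor_lift B t"
  for B :: "'a::rat_vector \<Rightarrow> 'b::rat_vector \<Rightarrow> 'c::rat_vector"
  using qlinear_tensor_lift[of B] unfolding qlinear_iff by blast+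

lemma tensor_lift_fun_add:
  assumes "qbilinear B" "qbilinear B'"
  shows "tensor_lift (\<lambda>a b. B a b + B' a b) t = tensor_lift B t + tensor_lift B' t"
proof -
  have "qbilinear (\<lambda>a b. B a b + B' a b)"
    using assms by (simp add: qbilinear_iff scaleQ_add_right)
  then show ?thesis using assms
    by (induction t rule: tensor_induct)
      (simp_all add: tensor_lift_tens tensor_lift_add tensor_lift_scaleQ scaleQ_add_right)
qed

lemma tensor_lift_fun_scaleQ:
  assumes "qbilinear B"
  shows "tensor_lift (\<lambda>a b. r *\<^sub>Q B a b) t = r *\<^sub>Q tensor_lift B t"
proof -
  have "qbilinear (\<lambda>a b. r *\<^sub>Q B a b)"
    using assms by (simp add: qbilinear_iff scaleQ_add_right mult.commute)
  then show ?thesis using assms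
    by (induction t rule: tensor_induct)
      (simp_all add: tensor_lift_tens tensor_lift_add tensor_lift_scaleQ scaleQ_add_right
        mult.commute)
qed

lemma tensor_map_tens:
  assumes "qlinear f" "qlinear g"
  shows "tensor_map f g (a \<otimes> b) = f a \<otimes> g b"
proof -
  have "qbilinear (\<lambda>a b. f a \<otimes> g b)"
    using assms by (simp add: qbilinear_iff qlinear_iff tens_add_left tens_add_right
        tens_scaleQ_left tens_scaleQ_right)
  then show ?thesis by (simp add: tensor_map_def tensor_lift_tens)
qed

lemma tensor_assoc_tens: "tensor_assoc ((a \<otimes> b) \<otimes> c) = a \<otimes> (b \<otimes> c)"
  for a :: "'a::rat_vector" and b :: "'b::rat_vector" and c :: "'c::rat_vector"
proof -
  have inner: "qbilinear (\<lambda>(a::'a) (b::'b). a \<otimes> (b \<otimes> (c::'c)))" for c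
    by (simp add: qbilinear_iff tens_add_left tens_add_right tens_scaleQ_left tens_scaleQ_right)
  have add: "tensor_lift (\<lambda>(a::'a) (b::'b). a \<otimes> (b \<otimes> (c + c'))) t =
      tensor_lift (\<lambda>a b. a \<otimes> (b \<otimes> c)) t + tensor_lift (\<lambda>a b. a \<otimes> (b \<otimes> c')) t"
    for c c' :: 'c and t
    by (simp add: tens_add_right tensor_lift_fun_add inner)
  have scale: "tensor_lift (\<lambda>(a::'a) (b::'b). a \<otimes> (b \<otimes> (r *\<^sub>Q c))) t =
      r *\<^sub>Q tensor_lift (\<lambda>a b. a \<otimes> (b \<otimes> c)) t" for c :: 'c and r t
    by (simp add: tens_scaleQ_right tensor_lift_fun_scaleQ inner)
  have "qbilinear (\<lambda>t (c::'c). tensor_lift (\<lambda>(a::'a) (b::'b). a \<otimes> (b \<otimes> c)) t)"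
    unfolding qbilinear_iff by (simp add: add scale tensor_lift_add tensor_lift_scaleQ)
  then show ?thesis by (simp add: tensor_assoc_def tensor_lift_tens inner)
qed

lemma tensor_mult_tens: "tensor_mult (a \<otimes> b) (c \<otimes> d) = (a * c) \<otimes> (b * d)"
  for a c :: "'a::rat_algebra_1" and b d :: "'b::rat_algebra_1"
proof -
  note bil = tens_add_left tens_add_right tens_scaleQ_left tens_scaleQ_right
    mult_scaleQ_left mult_scaleQ_right distrib_left distrib_right
  have inner: "qbilinear (\<lambda>(c::'a) (d::'b). (a * c) \<otimes> (b * d))" for a b
    by (simp add: qbilinear_iff bil)
  let ?L = "\<lambda>(a::'a) (b::'b) t. tensor_lift (\<lambda>c d. (a * c) \<otimes> (b * d)) t"
  have "?L a (b + b') t = ?L a b t + ?L a b' t" for a b b' t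
    by (simp add: bil tensor_lift_fun_add inner)
  moreover have "?L (a + a') b t = ?L a b t + ?L a' b t" for a a' b t
    by (simp add: bil tensor_lift_fun_add inner)
  moreover have "?L a (r *\<^sub>Q b) t = r *\<^sub>Q ?L a b t" for a b r t
    by (simp add: bil tensor_lift_fun_scaleQ inner)
  moreover have "?L (r *\<^sub>Q a) b t = r *\<^sub>Q ?L a b t" for a b r t
    by (simp add: bil tensor_lift_fun_scaleQ inner)
  ultimately have "qbilinear (\<lambda>a b. ?L a b t)" for t
    unfolding qbilinear_iff by blast
  then have "tensor_mult (a \<otimes> b) (c \<otimes> d) = ?L a b (c \<otimes> d)"
    unfolding tensor_mult_def by (rule tensor_lift_tens)
  also have "\<dots> = (a * c) \<otimes> (b * d)" by (rule tensor_lift_tens[OF inner])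
  finally show ?thesis .
qed

lemma tensor_lift_pairing: "tensor_lift (\<lambda>u v. u a * v b) (f \<otimes> g) = f a * (g b :: rat)"
  by (rule tensor_lift_tens) (simp add: qbilinear_iff scaleQ_fun_def algebra_simps)

section \<open>Graded connected Hopf algebras\<close>

locale hopf_algebra =
  fixes comult :: "'h::rat_algebra_1 \<Rightarrow> ('h, 'h) tensor"
    and counit :: "'h \<Rightarrow> rat"
    and antipode :: "'h \<Rightarrow> 'h"
  assumes linear_comult: "qlinear comult"
    and linear_counit: "qlinear counit"
    and linear_antipode: "qlinear antipode"
    and coassoc:
      "tensor_assoc (tensor_map comult (\<lambda>x. x) (comult x)) = tensor_map (\<lambda>x. x) comult (comult x)"
    and counit_left: "tensor_lift (\<lambda>a b. counit a *\<^sub>Q b) (comult x) = x"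
    and counit_right: "tensor_lift (\<lambda>a b. counit b *\<^sub>Q a) (comult x) = x"
    and comult_mult: "comult (x * y) = tensor_mult (comult x) (comult y)"
    and comult_one: "comult 1 = 1 \<otimes> 1"
    and counit_mult: "counit (x * y) = counit x * counit y"
    and counit_one: "counit 1 = 1"
    and antipode_left: "tensor_lift (\<lambda>a b. antipode a * b) (comult x) = counit x *\<^sub>Q 1"
    and antipode_right: "tensor_lift (\<lambda>a b. a * antipode b) (comult x) = counit x *\<^sub>Q 1"

definition is_decomposition ::
  "('i \<Rightarrow> 'a::rat_vector set) \<Rightarrow> 'a \<Rightarrow> ('i \<Rightarrow> 'a) \<Rightarrow> bool" where
  "is_decomposition gr x f \<longleftrightarrow>
     (\<forall>n. f n \<in> gr n) \<and> finite {n. f n \<noteq> 0} \<and> x = (\<Sum>n | f n \<noteq> 0. f n)"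

definition component :: "('i \<Rightarrow> 'a::rat_vector set) \<Rightarrow> 'i \<Rightarrow> 'a \<Rightarrow> 'a" where
  "component gr n x = (THE f. is_decomposition gr x f) n"

text \<open>\<open>\<nat>\<^sup>\<ell>\<close> is the type of functions \<open>'l \<Rightarrow> nat\<close> with \<open>'l\<close> finite,
  with pointwise addition and order.\<close>

locale graded_connected_hopf_algebra = hopf_algebra comult counit antipode
  for comult :: "'h::rat_algebra_1 \<Rightarrow> ('h, 'h) tensor"
    and counit :: "'h \<Rightarrow> rat"
    and antipode :: "'h \<Rightarrow> 'h" +
  fixes gr :: "('l::finite \<Rightarrow> nat) \<Rightarrow> 'h set"
  assumes subspace_gr: "qvs.subspace (gr n)"
    and direct_sum: "\<exists>!f. is_decomposition gr x f"
    and mult_gr: "a \<in> gr m \<Longrightarrow> b \<in> gr n \<Longrightarrow> a * b \<in> gr (m + n)"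
    and comult_gr: "x \<in> gr n \<Longrightarrow>
      comult x \<in> qvs.span (\<Union>(i, j)\<in>{(i, j). i + j = n}. tensor_span (gr i) (gr j))"
    and counit_gr: "x \<in> gr n \<Longrightarrow> n \<noteq> 0 \<Longrightarrow> counit x = 0"
    and antipode_gr: "x \<in> gr n \<Longrightarrow> antipode x \<in> gr n"
    and connected: "gr 0 = qvs.span {1}"
    and finite_dim_gr: "\<exists>B. finite B \<and> gr n = qvs.span B"

definition character :: "('h::rat_algebra_1 \<Rightarrow> rat) \<Rightarrow> bool" where
  "character \<phi> \<longleftrightarrow> qlinear \<phi> \<and> (\<forall>x y. \<phi> (x * y) = \<phi> x * \<phi> y) \<and> \<phi> 1 = 1"

section \<open>Subobjects\<close>

definition graded_subspace :: "('i \<Rightarrow> 'a::rat_vector set) \<Rightarrow> 'a set \<Rightarrow> bool" where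
  "graded_subspace gr V \<longleftrightarrow> qvs.subspace V \<and> V = qvs.span (\<Union>n. V \<inter> gr n)"

definition subcoalgebra :: "('a::rat_vector \<Rightarrow> ('a, 'a) tensor) \<Rightarrow> 'a set \<Rightarrow> bool" where
  "subcoalgebra \<Delta> C \<longleftrightarrow> qvs.subspace C \<and> (\<forall>x\<in>C. \<Delta> x \<in> tensor_span C C)"

definition graded_hopf_subalgebra ::
  "('i \<Rightarrow> 'h::rat_algebra_1 set) \<Rightarrow> ('h \<Rightarrow> ('h, 'h) tensor) \<Rightarrow> ('h \<Rightarrow> 'h) \<Rightarrow> 'h set \<Rightarrow> bool" where
  "graded_hopf_subalgebra gr \<Delta> S C \<longleftrightarrow>
     graded_subspace gr C \<and> 1 \<in> C \<and> (\<forall>x\<in>C. \<forall>y\<in>C. x * y \<in> C) \<and>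
     subcoalgebra \<Delta> C \<and> (\<forall>x\<in>C. S x \<in> C)"

text \<open>Ideals in an algebra whose carrier \<open>A\<close> is a subspace of the ambient type, with
  multiplication \<open>m\<close>.\<close>

definition two_sided_ideal ::
  "'a::rat_vector set \<Rightarrow> ('a \<Rightarrow> 'a \<Rightarrow> 'a) \<Rightarrow> 'a set \<Rightarrow> bool" where
  "two_sided_ideal A m J \<longleftrightarrow>
     J \<subseteq> A \<and> qvs.subspace J \<and> (\<forall>a\<in>A. \<forall>x\<in>J. m a x \<in> J \<and> m x a \<in> J)"

definition ideal_generated ::
  "'a::rat_vector set \<Rightarrow> ('a \<Rightarrow> 'a \<Rightarrow> 'a) \<Rightarrow> 'a set \<Rightarrow> 'a set" where
  "ideal_generated A m X = \<Inter>{J. two_sided_ideal A m J \<and> X \<subseteq> J}"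

definition hopf_ideal ::
  "'a::rat_vector set \<Rightarrow> ('a \<Rightarrow> 'a \<Rightarrow> 'a) \<Rightarrow> ('a \<Rightarrow> ('a, 'a) tensor) \<Rightarrow> ('a \<Rightarrow> rat)
     \<Rightarrow> ('a \<Rightarrow> 'a) \<Rightarrow> 'a set \<Rightarrow> bool" where
  "hopf_ideal A m \<Delta> \<epsilon> S J \<longleftrightarrow>
     two_sided_ideal A m J \<and>
     (\<forall>x\<in>J. \<Delta> x \<in> qvs.span (tensor_span J A \<union> tensor_span A J)) \<and>
     (\<forall>x\<in>J. \<epsilon> x = 0) \<and> (\<forall>x\<in>J. S x \<in> J)"

section \<open>The graded dual\<close>

text \<open>The dual of the component of degree \<open>n\<close> is identified with the linear functionals
  that vanish on all other components.\<close>

definition dual_gr :: "('i \<Rightarrow> 'h::rat_vector set) \<Rightarrow> 'i \<Rightarrow> ('h \<Rightarrow> rat) set" where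
  "dual_gr gr n = {f. qlinear f \<and> (\<forall>m. m \<noteq> n \<longrightarrow> (\<forall>x\<in>gr m. f x = 0))}"

definition graded_dual :: "('i \<Rightarrow> 'h::rat_vector set) \<Rightarrow> ('h \<Rightarrow> rat) set" where
  "graded_dual gr = qvs.span (\<Union>n. dual_gr gr n)"

definition dual_mult ::
  "('h::rat_vector \<Rightarrow> ('h, 'h) tensor) \<Rightarrow> ('h \<Rightarrow> rat) \<Rightarrow> ('h \<Rightarrow> rat) \<Rightarrow> ('h \<Rightarrow> rat)" where
  "dual_mult \<Delta> f g = (\<lambda>x. tensor_lift (\<lambda>a b. f a * g b) (\<Delta> x))"

text \<open>The unique element of \<open>H\<^sup>* \<otimes> H\<^sup>*\<close> whose value at
  \<open>a \<otimes> b\<close> is \<open>f (a * b)\<close>.\<close>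

definition dual_comult ::
  "('i \<Rightarrow> 'h::rat_algebra_1 set) \<Rightarrow> ('h \<Rightarrow> rat) \<Rightarrow> ('h \<Rightarrow> rat, 'h \<Rightarrow> rat) tensor" where
  "dual_comult gr f =
     (THE t. t \<in> tensor_span (graded_dual gr) (graded_dual gr) \<and>
        (\<forall>a b. tensor_lift (\<lambda>u v. u a * v b) t = f (a * b)))"

definition dual_counit :: "('h::rat_algebra_1 \<Rightarrow> rat) \<Rightarrow> rat" where
  "dual_counit f = f 1"

definition dual_antipode :: "('h \<Rightarrow> 'h) \<Rightarrow> ('h \<Rightarrow> rat) \<Rightarrow> ('h \<Rightarrow> rat)" where
  "dual_antipode S f = (\<lambda>x. f (S x))"

definition graded_hopf_ideal_of_dual ::
  "('i \<Rightarrow> 'h::rat_algebra_1 set) \<Rightarrow> ('h \<Rightarrow> ('h, 'h) tensor) \<Rightarrow> ('h \<Rightarrow> 'h)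
     \<Rightarrow> ('h \<Rightarrow> rat) set \<Rightarrow> bool" where
  "graded_hopf_ideal_of_dual gr \<Delta> S J \<longleftrightarrow>
     graded_subspace (dual_gr gr) J \<and>
     hopf_ideal (graded_dual gr) (dual_mult \<Delta>) (dual_comult gr) dual_counit (dual_antipode S) J"

text \<open>The restriction of \<open>\<phi>\<close> to degree \<open>n\<close>, extended by zero to the other components.\<close>

definition restrict_deg ::
  "('i \<Rightarrow> 'h::rat_vector set) \<Rightarrow> ('h \<Rightarrow> rat) \<Rightarrow> 'i \<Rightarrow> ('h \<Rightarrow> rat)" where
  "restrict_deg gr \<phi> n = (\<lambda>x. \<phi> (component gr n x))"

section \<open>The subcoalgebra and the ideal attached to two functionals\<close>

definition deg_le :: "('l \<Rightarrow> nat) \<Rightarrow> ('l \<Rightarrow> enat) \<Rightarrow> bool" where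
  "deg_le n k \<longleftrightarrow> (\<lambda>i. enat (n i)) \<le> k"

definition equalizing_subcoalgebra ::
  "(('l \<Rightarrow> nat) \<Rightarrow> 'h::rat_vector set) \<Rightarrow> ('h \<Rightarrow> ('h, 'h) tensor) \<Rightarrow> ('l \<Rightarrow> enat)
     \<Rightarrow> ('h \<Rightarrow> rat) \<Rightarrow> ('h \<Rightarrow> rat) \<Rightarrow> 'h set \<Rightarrow> bool" where
  "equalizing_subcoalgebra gr \<Delta> k \<phi> \<psi> C \<longleftrightarrow>
     graded_subspace gr C \<and> subcoalgebra \<Delta> C \<and>
     (\<forall>h \<in> C \<inter> qvs.span (\<Union>n\<in>{n. deg_le n k}. gr n). \<phi> h = \<psi> h)"

definition S_sub ::
  "(('l \<Rightarrow> nat) \<Rightarrow> 'h::rat_vector set) \<Rightarrow> ('h \<Rightarrow> ('h, 'h) tensor) \<Rightarrow> ('l \<Rightarrow> enat)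
     \<Rightarrow> ('h \<Rightarrow> rat) \<Rightarrow> ('h \<Rightarrow> rat) \<Rightarrow> 'h set" where
  "S_sub gr \<Delta> k \<phi> \<psi> = (GREATEST C. equalizing_subcoalgebra gr \<Delta> k \<phi> \<psi> C)"

definition I_ideal ::
  "(('l \<Rightarrow> nat) \<Rightarrow> 'h::rat_vector set) \<Rightarrow> ('h \<Rightarrow> ('h, 'h) tensor) \<Rightarrow> ('l \<Rightarrow> enat)
     \<Rightarrow> ('h \<Rightarrow> rat) \<Rightarrow> ('h \<Rightarrow> rat) \<Rightarrow> ('h \<Rightarrow> rat) set" where
  "I_ideal gr \<Delta> k \<phi> \<psi> = ideal_generated (graded_dual gr) (dual_mult \<Delta>)
     {restrict_deg gr \<phi> n - restrict_deg gr \<psi> n | n. deg_le n k}"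

definition annihilator :: "('h \<Rightarrow> rat) set \<Rightarrow> 'h set" where
  "annihilator J = {h. \<forall>f\<in>J. f h = 0}"

end

theory Submission
  imports Defs "HOL-Library.FuncSet"
begin

text \<open>Write \<open>C\<close> for the annihilator of \<open>I\<close>. An equalizing subcoalgebra \<open>E\<close> has an ideal
  as its annihilator in the graded dual, and this ideal contains the generators of \<open>I\<close>; hence
  \<open>E \<subseteq> C\<close>. Conversely \<open>I\<close> is graded with finite-dimensional components, so every element of
  the graded dual that vanishes on \<open>C\<close> lies in \<open>I\<close>; with a graded projection \<open>p\<close> onto \<open>C\<close>
  the ideal property says \<open>\<Delta> x = (p \<otimes> p) (\<Delta> x)\<close> for \<open>x \<in> C\<close>, so \<open>C\<close> is itself an
  equalizing subcoalgebra. By maximality \<open>C\<close> contains \<open>1\<close> and \<open>C * C\<close>, as both span equalizing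
  subcoalgebras: this is where \<open>\<phi>\<close> and \<open>\<psi>\<close> being characters enters. Stability under the antipode
  follows by recursion on the degree, and the Hopf ideal properties of \<open>I\<close> are those of \<open>C\<close>
  read through the duality.\<close>

section \<open>Linear algebra over the rationals\<close>

global_interpretation qvsp: vector_space_pair
  "scaleQ :: rat \<Rightarrow> 'a \<Rightarrow> 'a::rat_vector" "scaleQ :: rat \<Rightarrow> 'b \<Rightarrow> 'b::rat_vector"
  by unfold_locales

lemma qlinear_add: "qlinear f \<Longrightarrow> f (x + y) = f x + f y"
  and qlinear_scaleQ: "qlinear f \<Longrightarrow> f (c *\<^sub>Q x) = c *\<^sub>Q f x"
  by (simp_all add: qlinear_iff)

lemma qlinear_zero: "qlinear f \<Longrightarrow> f 0 = 0"
  using qlinear_scaleQ[of f 0 0] by simp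

lemma qlinear_diff: "qlinear f \<Longrightarrow> f (x - y) = f x - f y"
  using qlinear_add[of f "x - y" y] by (simp add: algebra_simps)

lemma qlinear_sum: "qlinear f \<Longrightarrow> f (sum g A) = (\<Sum>a\<in>A. f (g a))"
  by (rule qvsp.linear_sum)

lemma qlinear_comp: "qlinear f \<Longrightarrow> qlinear g \<Longrightarrow> qlinear (\<lambda>x. f (g x))"
  by (simp add: qlinear_iff)

lemma qlinear_fun_diff: "qlinear f \<Longrightarrow> qlinear g \<Longrightarrow> qlinear (\<lambda>x. f x - g x)"
  by (simp add: qlinear_iff qvs.scale_right_diff_distrib)

lemma subspace_qlinear: "qvs.subspace {f. qlinear f}"
  by (rule qvs.subspaceI)
    (auto simp: qlinear_iff scaleQ_fun_def scaleQ_add_right mult.commute)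

lemma qlinear_span_into:
  assumes "qlinear F" "qvs.subspace U" "\<And>x. x \<in> X \<Longrightarrow> F x \<in> U" "t \<in> qvs.span X"
  shows "F t \<in> U"
proof -
  have "qvs.subspace {x. F x \<in> U}"
    using assms(1,2) by (intro qvs.subspaceI)
      (auto simp: qlinear_zero qlinear_add qlinear_scaleQ qvs.subspace_0 qvs.subspace_add
        qvs.subspace_scale)
  then have "qvs.span X \<subseteq> {x. F x \<in> U}" using assms(3) by (intro qvs.span_minimal) auto
  then show ?thesis using assms(4) by auto
qed

lemma qlinear_span_zero:
  assumes "qlinear F" "\<And>x. x \<in> X \<Longrightarrow> F x = 0" "t \<in> qvs.span X"
  shows "F t = 0"
  using qlinear_span_into[of F "{0}" X t] assms by (simp add: qvs.subspace_single_0)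

section \<open>Functionals, projections and coordinates\<close>

lemma exists_functional_nonzero:
  assumes "(x::'a::rat_vector) \<noteq> 0"
  shows "\<exists>f::'a \<Rightarrow> rat. qlinear f \<and> f x \<noteq> 0"
proof -
  have "qvs.independent {x}" using assms by simp
  from qvsp.linear_independent_extend[OF this, of "\<lambda>_. 1::rat"]
  show ?thesis by force
qed

lemma exists_projection:
  assumes "qvs.subspace (V::'a::rat_vector set)"
  shows "\<exists>p. qlinear p \<and> (\<forall>x. p x \<in> V) \<and> (\<forall>x\<in>V. p x = x)"
  using qvsp.linear_exists_left_inverse_on[OF qlinear_id assms] by (auto simp: image_subset_iff)

text \<open>A basis \<open>E\<close> of the span is extracted from \<open>B\<close>; the functionals
  are its dual basis, extended to the whole space. Both sides of the expansion are linear in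
  \<open>x\<close> and agree on \<open>E\<close>.\<close>

lemma exists_coordinates:
  assumes "finite B"
  shows "\<exists>E c. finite E \<and> E \<subseteq> qvs.span B \<and> (\<forall>e. qlinear (c e :: 'a::rat_vector \<Rightarrow> rat)) \<and>
    (\<forall>x\<in>qvs.span B. x = (\<Sum>e\<in>E. c e x *\<^sub>Q e))"
proof -
  obtain E where E: "E \<subseteq> B" "qvs.independent E" "B \<subseteq> qvs.span E"
    by (rule qvs.maximal_independent_subset)
  have fin: "finite E" using E(1) assms by (rule finite_subset)
  have "\<exists>g. qlinear g \<and> (\<forall>x\<in>E. g x = (if x = e then 1 else 0 :: rat))" for e
    by (rule qvsp.linear_independent_extend[OF E(2)])
  then obtain c where c: "\<And>e. qlinear (c e)" "\<And>e x. x \<in> E \<Longrightarrow> c e x = (if x = e then 1 else 0 :: rat)"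
    by metis
  have "x - (\<Sum>e\<in>E. c e x *\<^sub>Q e) = 0" if "x \<in> qvs.span B" for x
  proof (rule qlinear_span_zero[where X = E and F = "\<lambda>x. x - (\<Sum>e\<in>E. c e x *\<^sub>Q e)"])
    show "qlinear (\<lambda>x. x - (\<Sum>e\<in>E. c e x *\<^sub>Q e))"
      by (simp add: qlinear_iff qlinear_add[OF c(1)] qlinear_scaleQ[OF c(1)] scaleQ_add_left
          sum.distrib qvs.scale_right_diff_distrib qvs.scale_sum_right)
    show "x - (\<Sum>e\<in>E. c e x *\<^sub>Q e) = 0" if "x \<in> E" for x
    proof -
      have "(\<Sum>e\<in>E. c e x *\<^sub>Q e) = (\<Sum>e\<in>E. if e = x then x else 0)"
        using that by (intro sum.cong) (auto simp: c(2))
      then show ?thesis using that fin by simp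
    qed
    show "x \<in> qvs.span E"
      using that E(3) by (meson qvs.span_minimal qvs.subspace_span subsetD)
  qed
  moreover have "E \<subseteq> qvs.span B" using E(1) qvs.span_superset by blast
  ultimately show ?thesis using fin c(1) by (intro exI[of _ E] exI[of _ c]) auto
qed

text \<open>Induction on \<open>G\<close>. Either \<open>g\<close> vanishes on the common kernel of
  the other functionals and is redundant, or some \<open>x0\<close> in that kernel has
  \<open>g x0 \<noteq> 0\<close>, and a multiple of \<open>g\<close> can be subtracted from
  \<open>f\<close>.\<close>

lemma functional_in_span:
  assumes "finite G" "\<forall>g\<in>G. qlinear g" "qlinear f"
    and "\<And>x. (\<forall>g\<in>G. g x = 0) \<Longrightarrow> f x = 0"
  shows "(f :: 'a::rat_vector \<Rightarrow> rat) \<in> qvs.span G"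
  using assms
proof (induction G arbitrary: f rule: finite_induct)
  case empty
  then have "f = 0" by (simp add: fun_eq_iff)
  show ?case unfolding \<open>f = 0\<close> by (rule qvs.span_zero)
next
  case (insert g G)
  have lin: "qlinear g" using insert.prems(1) by blast
  show ?case
  proof (cases "\<exists>x0. (\<forall>h\<in>G. h x0 = 0) \<and> g x0 \<noteq> 0")
    case False
    then have "f \<in> qvs.span G" using insert.prems by (intro insert.IH) (blast, blast, metis insertE)
    then show ?thesis using qvs.span_mono[OF subset_insertI] by blast
  next
    case True
    then obtain x0 where x0: "\<forall>h\<in>G. h x0 = 0" "g x0 \<noteq> 0" by blast
    \<comment> \<open>Chosen so that \<open>f - r *\<^sub>Q g\<close> vanishes at
      \<open>x0\<close>.\<close>
    define r where "r = f x0 / g x0"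
    have "f - r *\<^sub>Q g \<in> qvs.span G"
    proof (rule insert.IH)
      show "\<forall>h\<in>G. qlinear h" using insert.prems(1) by blast
      show "qlinear (f - r *\<^sub>Q g)"
        using qvs.subspace_diff[OF subspace_qlinear] qvs.subspace_scale[OF subspace_qlinear]
          insert.prems(2) lin by blast
      fix x assume x: "\<forall>h\<in>G. h x = 0"
      \<comment> \<open>Correcting \<open>x\<close> by a multiple of \<open>x0\<close> stays in the
        kernel of \<open>G\<close> and enters the kernel of \<open>g\<close>, so the hypothesis on
        \<open>f\<close> applies.\<close>
      have "f (x - (g x / g x0) *\<^sub>Q x0) = 0"
      proof (rule insert.prems(3), rule ballI)
        fix h assume h: "h \<in> insert g G"
        then have hl: "qlinear h" using insert.prems(1) by blast
        have "h (x - (g x / g x0) *\<^sub>Q x0) = h x - g x / g x0 * h x0"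
          by (simp add: qlinear_diff[OF hl] qlinear_scaleQ[OF hl])
        then show "h (x - (g x / g x0) *\<^sub>Q x0) = 0" using h x x0 by auto
      qed
      then have "f x = g x / g x0 * f x0"
        by (simp add: qlinear_diff[OF insert.prems(2)] qlinear_scaleQ[OF insert.prems(2)])
      then show "(f - r *\<^sub>Q g) x = 0" by (simp add: scaleQ_fun_def r_def)
    qed
    then have "f - r *\<^sub>Q g \<in> qvs.span (insert g G)"
      using qvs.span_mono[OF subset_insertI] by blast
    then have "(f - r *\<^sub>Q g) + r *\<^sub>Q g \<in> qvs.span (insert g G)"
      by (rule qvs.span_add) (simp add: qvs.span_scale qvs.span_base)
    then show ?thesis by simp
  qed
qed

section \<open>Tensor products\<close>

lemma tens_sum_left: "sum f A \<otimes> b = (\<Sum>a\<in>A. f a \<otimes> b)"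
  using qbilinear_tens by (intro qlinear_sum[of "\<lambda>a. a \<otimes> b"]) (auto simp: qbilinear_def)

lemma tens_zero_right [simp]: "a \<otimes> 0 = 0"
  using tens_scaleQ_right[of a 0 0] by simp

lemma tens_diff_left: "(a - a') \<otimes> b = a \<otimes> b - a' \<otimes> b"
  and tens_diff_right: "a \<otimes> (b - b') = a \<otimes> b - a \<otimes> b'"
  using tens_add_left[of "a - a'" a' b] tens_add_right[of a "b - b'" b']
  by (simp_all add: algebra_simps)

lemma qlinear_tensor_eqI:
  assumes "qlinear F" "qlinear G" "\<And>a b. F (a \<otimes> b) = G (a \<otimes> b)"
  shows "F t = G t"
  by (induction t rule: tensor_induct)
    (simp_all add: assms qlinear_add[OF assms(1)] qlinear_add[OF assms(2)]
      qlinear_scaleQ[OF assms(1)] qlinear_scaleQ[OF assms(2)])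

section \<open>Tensor spans and products of functionals\<close>

lemma tensor_span_into:
  assumes "qlinear F" "qvs.subspace U" "\<And>a b. a \<in> V \<Longrightarrow> b \<in> W \<Longrightarrow> F (a \<otimes> b) \<in> U"
    and "t \<in> tensor_span V W"
  shows "F t \<in> U"
  using qlinear_span_into[OF assms(1,2) _ assms(4)[unfolded tensor_span_def]] assms(3) by blast

lemma tens_in_tensor_span: "a \<in> V \<Longrightarrow> b \<in> W \<Longrightarrow> a \<otimes> b \<in> tensor_span V W"
  unfolding tensor_span_def by (rule qvs.span_base) blast

lemma subspace_tensor_span: "qvs.subspace (tensor_span V W)"
  by (simp add: tensor_span_def)

lemma qlinear_tensor_map: "qlinear (tensor_map f g)"
  by (simp add: tensor_map_def qlinear_tensor_lift)

definition tensor_functional ::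
  "('a::rat_vector \<Rightarrow> rat) \<Rightarrow> ('b::rat_vector \<Rightarrow> rat) \<Rightarrow> ('a, 'b) tensor \<Rightarrow> rat" where
  "tensor_functional f g = tensor_lift (\<lambda>a b. f a * g b)"

lemma qlinear_tensor_functional: "qlinear (tensor_functional f g)"
  by (simp add: tensor_functional_def qlinear_tensor_lift)

lemma qbilinear_functionals:
  "qlinear f \<Longrightarrow> qlinear g \<Longrightarrow> qbilinear (\<lambda>a b. f a * g b :: rat)"
  by (simp add: qbilinear_iff qlinear_iff algebra_simps)

lemma tensor_functional_tens:
  "qlinear f \<Longrightarrow> qlinear g \<Longrightarrow> tensor_functional f g (a \<otimes> b) = f a * g b"
  by (simp add: tensor_functional_def tensor_lift_tens qbilinear_functionals)

lemma tensor_functional_map: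
  assumes "qlinear f" "qlinear g" "qlinear p" "qlinear q"
  shows "tensor_functional f g (tensor_map p q t) =
    tensor_functional (\<lambda>x. f (p x)) (\<lambda>x. g (q x)) t"
  by (rule qlinear_tensor_eqI[where F = "\<lambda>t. tensor_functional f g (tensor_map p q t)"])
    (simp_all add: qlinear_comp[OF qlinear_tensor_functional qlinear_tensor_map]
      qlinear_tensor_functional tensor_map_tens tensor_functional_tens assms qlinear_comp)

text \<open>Telescoping: each summand on the right has a difference as one factor. When these
  differences lie in an ideal, both summands do too.\<close>

lemma tensor_functional_diff:
  assumes "qlinear f" "qlinear g" "qlinear f'" "qlinear g'"
  shows "tensor_functional f g t - tensor_functional f' g' t =
    tensor_functional (\<lambda>x. f x - f' x) g t + tensor_functional f' (\<lambda>x. g x - g' x) t"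
proof -
  have d: "qlinear (\<lambda>x. f x - f' x)" "qlinear (\<lambda>x. g x - g' x)"
    using assms by (auto intro: qlinear_fun_diff)
  show ?thesis
    by (induction t rule: tensor_induct)
      (simp_all add: tensor_functional_tens assms d qlinear_add[OF qlinear_tensor_functional]
        qlinear_scaleQ[OF qlinear_tensor_functional] algebra_simps)
qed

lemma tensor_basis_expansion:
  assumes "qvs.span B = UNIV"
  shows "\<exists>F w. finite F \<and> F \<subseteq> B \<and> (t :: ('a::rat_vector, 'b::rat_vector) tensor) = (\<Sum>b\<in>F. b \<otimes> w b)"
proof -
  \<comment> \<open>The clause that \<open>w\<close> vanishes off \<open>F\<close> lets two
    expansions be rewritten over the common index set \<open>F \<union> G\<close>.\<close>
  define P where "P = (\<lambda>t::('a, 'b) tensor. \<exists>F w. finite F \<and> F \<subseteq> B \<and> (\<forall>b. b \<notin> F \<longrightarrow> w b = 0) \<and>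
      t = (\<Sum>b\<in>F. b \<otimes> w b))"
  have "P t"
  proof (induction t rule: tensor_induct)
    case (tens a b)
    have "a \<in> qvs.span B" using assms by simp
    then obtain F r where F: "finite F" "F \<subseteq> B" "a = (\<Sum>b\<in>F. r b *\<^sub>Q b)"
      unfolding qvs.span_explicit by blast
    have "a \<otimes> b = (\<Sum>e\<in>F. e \<otimes> (if e \<in> F then r e *\<^sub>Q b else 0))"
      by (simp add: F(3) tens_sum_left tens_scaleQ_left tens_scaleQ_right)
    then show ?case unfolding P_def using F(1,2)
      by (intro exI[of _ F] exI[of _ "\<lambda>e. if e \<in> F then r e *\<^sub>Q b else 0"]) auto
  next
    case (add s t)
    then obtain F w G v where *: "finite F" "F \<subseteq> B" "\<forall>b. b \<notin> F \<longrightarrow> w b = 0" "s = (\<Sum>b\<in>F. b \<otimes> w b)"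
      "finite G" "G \<subseteq> B" "\<forall>b. b \<notin> G \<longrightarrow> v b = 0" "t = (\<Sum>b\<in>G. b \<otimes> v b)"
      unfolding P_def by blast
    have "s = (\<Sum>b\<in>F \<union> G. b \<otimes> w b)" "t = (\<Sum>b\<in>F \<union> G. b \<otimes> v b)"
      unfolding *(4,8) using * by (auto intro!: sum.mono_neutral_left)
    then have "s + t = (\<Sum>b\<in>F \<union> G. b \<otimes> (w b + v b))"
      by (simp add: tens_add_right sum.distrib)
    then show ?case unfolding P_def using *
      by (intro exI[of _ "F \<union> G"] exI[of _ "\<lambda>b. w b + v b"]) auto
  next
    case (scaleQ c t)
    then obtain F w where *: "finite F" "F \<subseteq> B" "\<forall>b. b \<notin> F \<longrightarrow> w b = 0" "t = (\<Sum>b\<in>F. b \<otimes> w b)"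
      unfolding P_def by blast
    then show ?case unfolding P_def
      by (intro exI[of _ F] exI[of _ "\<lambda>b. c *\<^sub>Q w b"])
        (auto simp: tens_scaleQ_right qvs.scale_sum_right)
  qed
  then show ?thesis unfolding P_def by blast
qed

text \<open>Separating sets, not all functionals: \<open>P\<close> and \<open>Q\<close> are later the graded dual, which is
  a proper subspace of the dual, and the point evaluations on spaces of functions.\<close>

lemma tensor_separation:
  assumes P: "\<And>f. f \<in> P \<Longrightarrow> qlinear f" "\<And>x. (\<forall>f\<in>P. f x = 0) \<Longrightarrow> x = 0"
    and Q: "\<And>g. g \<in> Q \<Longrightarrow> qlinear g" "\<And>y. (\<forall>g\<in>Q. g y = 0) \<Longrightarrow> y = 0"
    and t: "\<And>f g. f \<in> P \<Longrightarrow> g \<in> Q \<Longrightarrow> tensor_functional f g t = 0"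
  shows "(t :: ('a::rat_vector, 'b::rat_vector) tensor) = 0"
proof -
  obtain B :: "'a set" where B: "qvs.independent B" "UNIV \<subseteq> qvs.span B"
    using qvs.maximal_independent_subset[of UNIV] by blast
  then obtain F w where F: "finite F" "F \<subseteq> B" "t = (\<Sum>b\<in>F. b \<otimes> w b)"
    using tensor_basis_expansion[of B t] by blast
  have "g (w b) = 0" if g: "g \<in> Q" and b: "b \<in> F" for g b
  proof -
    \<comment> \<open>Applying \<open>f\<close> to this sum gives the pairing of \<open>f\<close>
      and \<open>g\<close> with \<open>t\<close>, so \<open>P\<close> forces it to be zero;
      independence of \<open>B\<close> then kills each coefficient.\<close>
    have "(\<Sum>b\<in>F. g (w b) *\<^sub>Q b) = 0"
    proof (rule P(2), rule ballI)
      fix f assume f: "f \<in> P"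
      have "f (\<Sum>b\<in>F. g (w b) *\<^sub>Q b) = tensor_functional f g t"
        by (simp add: F(3) qlinear_sum[OF P(1)[OF f]] qlinear_scaleQ[OF P(1)[OF f]] P(1)[OF f] Q(1)[OF g]
            qlinear_sum[OF qlinear_tensor_functional] tensor_functional_tens mult.commute)
      then show "f (\<Sum>b\<in>F. g (w b) *\<^sub>Q b) = 0" using t[OF f g] by simp
    qed
    then show ?thesis using B(1) F(1,2) b qvs.independentD[of B F "\<lambda>b. g (w b)" b] by blast
  qed
  then have "w b = 0" if "b \<in> F" for b using Q(2) that by blast
  then show ?thesis by (simp add: F(3))
qed

text \<open>The nested lift defining \<open>tensor_mult\<close> is visibly linear only in its first
  argument. With an elementary tensor there, the outer lift evaluates and linearity in
  \<open>t\<close> becomes visible.\<close>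

lemma tensor_mult_tens_left:
  "tensor_mult (a \<otimes> b) t = tensor_lift (\<lambda>c d. (a * c) \<otimes> (b * d)) t"
  for a :: "'a::rat_algebra_1" and b :: "'b::rat_algebra_1"
proof -
  note bil = tens_add_left tens_add_right tens_scaleQ_left tens_scaleQ_right
    mult_scaleQ_left mult_scaleQ_right distrib_left distrib_right
  have inner: "qbilinear (\<lambda>(c::'a) (d::'b). (a * c) \<otimes> (b * d))" for a b
    by (simp add: qbilinear_iff bil)
  have "qbilinear (\<lambda>(a::'a) (b::'b). tensor_lift (\<lambda>c d. (a * c) \<otimes> (b * d)) t)"
    unfolding qbilinear_iff by (simp add: bil tensor_lift_fun_add tensor_lift_fun_scaleQ inner)
  then show ?thesis unfolding tensor_mult_def by (rule tensor_lift_tens)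
qed

lemma tensor_mult_in_tensor_span:
  assumes s: "s \<in> tensor_span V V" and t: "t \<in> tensor_span V V"
    and M: "\<And>a b. a \<in> V \<Longrightarrow> b \<in> V \<Longrightarrow> a * b \<in> M"
  shows "tensor_mult s t \<in> tensor_span M M"
proof -
  have "qlinear (\<lambda>s. tensor_mult s t)"
    unfolding tensor_mult_def by (rule qlinear_tensor_lift)
  then show ?thesis
  proof (rule tensor_span_into[OF _ subspace_tensor_span _ s])
    fix a b assume ab: "a \<in> V" "b \<in> V"
    have lin: "qlinear (tensor_mult (a \<otimes> b))"
      unfolding tensor_mult_tens_left[abs_def] by (rule qlinear_tensor_lift)
    show "tensor_mult (a \<otimes> b) t \<in> tensor_span M M"
      using ab by (intro tensor_span_into[OF lin subspace_tensor_span _ t])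
        (simp add: tensor_mult_tens tens_in_tensor_span M)
  qed
qed


text \<open>This yields the uniqueness behind the definite description in
  \<open>dual_comult\<close>, and reduces vanishing of a tensor of functionals to evaluation at
  pairs of vectors.\<close>

lemma tensor_eval_eq_zero:
  assumes "\<And>a b. tensor_lift (\<lambda>u v. u a * v b) t = 0"
  shows "(t :: ('a \<Rightarrow> rat, 'b \<Rightarrow> rat) tensor) = 0"
proof (rule tensor_separation[where P = "range (\<lambda>a u. u a)" and Q = "range (\<lambda>b v. v b)"])
  show "tensor_functional f g t = 0"
    if "f \<in> range (\<lambda>a u. u a)" "g \<in> range (\<lambda>b v. v b)" for f g
    using that assms by (auto simp: tensor_functional_def)
qed (auto simp: qlinear_iff scaleQ_fun_def fun_eq_iff)

section \<open>Graded vector spaces and their graded duals\<close>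

lemma qlinear_precompose: "qlinear (\<lambda>f x. f (p x))"
  by (simp add: qlinear_iff fun_eq_iff scaleQ_fun_def)

lemma subspace_dual_gr: "qvs.subspace (dual_gr gr n)"
  unfolding dual_gr_def by (rule qvs.subspaceI)
    (auto simp: qlinear_iff scaleQ_fun_def algebra_simps)

lemma dual_gr_qlinear: "f \<in> dual_gr gr n \<Longrightarrow> qlinear f"
  by (simp add: dual_gr_def)

lemma dual_gr_subset_graded_dual: "f \<in> dual_gr gr n \<Longrightarrow> f \<in> graded_dual gr"
  unfolding graded_dual_def by (rule qvs.span_base) blast

lemma subspace_graded_dual: "qvs.subspace (graded_dual gr)"
  by (simp add: graded_dual_def)

lemma graded_dual_qlinear: "f \<in> graded_dual gr \<Longrightarrow> qlinear f"
proof -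
  have "graded_dual gr \<subseteq> {f. qlinear f}"
    unfolding graded_dual_def
    by (rule qvs.span_minimal[OF _ subspace_qlinear]) (auto simp: dual_gr_def)
  then show "f \<in> graded_dual gr \<Longrightarrow> qlinear f" by blast
qed

lemma graded_dual_precompose:
  assumes "qlinear p" "\<And>n x. x \<in> gr n \<Longrightarrow> p x \<in> gr n" "f \<in> graded_dual gr"
  shows "(\<lambda>x. f (p x)) \<in> graded_dual gr"
proof (rule qlinear_span_into[OF qlinear_precompose subspace_graded_dual _
      assms(3)[unfolded graded_dual_def]])
  fix f assume "f \<in> (\<Union>n. dual_gr gr n)"
  then obtain n where "f \<in> dual_gr gr n" by blast
  then have "(\<lambda>x. f (p x)) \<in> dual_gr gr n"
    using assms(1,2) by (auto simp: dual_gr_def intro: qlinear_comp)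
  then show "(\<lambda>x. f (p x)) \<in> graded_dual gr" by (rule dual_gr_subset_graded_dual)
qed

section \<open>Homogeneous components and graded subspaces\<close>

locale graded_vector_space =
  fixes gr :: "'i \<Rightarrow> 'a::rat_vector set"
  assumes subspace_homogeneous: "qvs.subspace (gr n)"
    and unique_decomposition: "\<exists>!f. is_decomposition gr x f"
begin

lemma decomposition_component: "is_decomposition gr x (\<lambda>n. component gr n x)"
  unfolding component_def by (rule theI'[OF unique_decomposition])

lemma component_in: "component gr n x \<in> gr n"
  and finite_support: "finite {n. component gr n x \<noteq> 0}"
  using decomposition_component[of x] by (auto simp: is_decomposition_def)

lemma component_sum:
  assumes "finite N" "\<And>n. n \<notin> N \<Longrightarrow> component gr n x = 0"
  shows "(\<Sum>n\<in>N. component gr n x) = x"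
proof -
  have "x = (\<Sum>n | component gr n x \<noteq> 0. component gr n x)"
    using decomposition_component[of x] by (simp add: is_decomposition_def)
  also have "\<dots> = (\<Sum>n\<in>N. component gr n x)"
    using assms by (intro sum.mono_neutral_left) auto
  finally show ?thesis by simp
qed

lemma component_unique:
  assumes "finite N" "\<And>n. f n \<in> gr n" "\<And>n. n \<notin> N \<Longrightarrow> f n = 0" "x = (\<Sum>n\<in>N. f n)"
  shows "component gr n x = f n"
proof -
  have fin: "finite {n. f n \<noteq> 0}"
    using assms(1,3) by (metis (mono_tags, lifting) finite_subset mem_Collect_eq subsetI)
  have "x = (\<Sum>n | f n \<noteq> 0. f n)"
    unfolding assms(4) using assms(1,3) by (intro sum.mono_neutral_right) auto
  then have "is_decomposition gr x f" using assms(2) fin by (simp add: is_decomposition_def)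
  then have "(\<lambda>n. component gr n x) = f"
    using unique_decomposition decomposition_component by blast
  then show ?thesis by (rule fun_cong)
qed

lemma component_homogeneous: "x \<in> gr n \<Longrightarrow> component gr m x = (if m = n then x else 0)"
  by (rule component_unique[of "{n}"]) (auto simp: qvs.subspace_0[OF subspace_homogeneous])

lemma qlinear_component: "qlinear (component gr n)"
  unfolding qlinear_iff
proof (intro conjI allI)
  fix x y c
  \<comment> \<open>Both decompositions are written over one finite index set, so that uniqueness
    applies to the termwise sum.\<close>
  let ?N = "{n. component gr n x \<noteq> 0} \<union> {n. component gr n y \<noteq> 0}"
  have fin: "finite ?N" by (simp add: finite_support)
  have x: "x = (\<Sum>n\<in>?N. component gr n x)" and y: "y = (\<Sum>n\<in>?N. component gr n y)"
    by (rule component_sum[symmetric]; simp add: finite_support)+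
  show "component gr n (x + y) = component gr n x + component gr n y"
    by (rule component_unique[OF fin])
      (auto simp: qvs.subspace_add[OF subspace_homogeneous] component_in sum.distrib
        x[symmetric] y[symmetric])
  show "component gr n (c *\<^sub>Q x) = c *\<^sub>Q component gr n x"
    by (rule component_unique[OF fin])
      (auto simp: qvs.subspace_scale[OF subspace_homogeneous] component_in
        qvs.scale_sum_right[symmetric] x[symmetric])
qed

lemma qlinear_eq_on_homogeneous:
  assumes "qlinear f" "qlinear g" "\<And>n x. x \<in> gr n \<Longrightarrow> f x = g x"
  shows "f x = g x"
proof -
  have x: "x = (\<Sum>n | component gr n x \<noteq> 0. component gr n x)"
    by (rule component_sum[symmetric]) (simp_all add: finite_support)
  show ?thesis
    by (subst (1 2) x) (simp add: qlinear_sum assms(1,2) assms(3)[OF component_in])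
qed

lemma graded_subspace_component:
  assumes "graded_subspace gr V" "x \<in> V"
  shows "component gr n x \<in> V"
proof (rule qlinear_span_into[OF qlinear_component])
  show "qvs.subspace V" "x \<in> qvs.span (\<Union>n. V \<inter> gr n)"
    using assms by (auto simp: graded_subspace_def)
  then show "component gr n x \<in> V" if "x \<in> (\<Union>n. V \<inter> gr n)" for x
    using that by (auto simp: component_homogeneous qvs.subspace_0)
qed

lemma graded_subspaceI:
  assumes "qvs.subspace V" "\<And>n x. x \<in> V \<Longrightarrow> component gr n x \<in> V"
  shows "graded_subspace gr V"
proof -
  have "x \<in> qvs.span (\<Union>n. V \<inter> gr n)" if "x \<in> V" for x
  proof -
    have "(\<Sum>n | component gr n x \<noteq> 0. component gr n x) \<in> qvs.span (\<Union>n. V \<inter> gr n)"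
      using that assms(2) component_in by (intro qvs.span_sum qvs.span_base) blast
    then show ?thesis by (subst (asm) component_sum) (simp_all add: finite_support)
  qed
  moreover have "qvs.span (\<Union>n. V \<inter> gr n) \<subseteq> V"
    using assms(1) by (intro qvs.span_minimal) auto
  ultimately show ?thesis using assms(1) by (auto simp: graded_subspace_def)
qed

lemma graded_subspace_span:
  assumes "X \<subseteq> (\<Union>n. gr n)"
  shows "graded_subspace gr (qvs.span X)"
proof (rule graded_subspaceI)
  fix n x assume "x \<in> qvs.span X"
  then show "component gr n x \<in> qvs.span X"
  proof (rule qlinear_span_into[OF qlinear_component qvs.subspace_span, rotated])
    fix x assume "x \<in> X"
    then show "component gr n x \<in> qvs.span X"
      using assms by (auto simp: component_homogeneous qvs.span_zero qvs.span_base)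
  qed
qed simp

text \<open>Projections onto the pieces \<open>C \<inter> gr n\<close> are chosen degree by degree
  and glued along the decomposition. Preserving degrees is what keeps composites with members of the
  graded dual inside the graded dual.\<close>

lemma graded_projection_exists:
  assumes C: "graded_subspace gr C"
  shows "\<exists>p. qlinear p \<and> (\<forall>x\<in>C. p x = x) \<and> (\<forall>n. \<forall>x\<in>gr n. p x \<in> C \<inter> gr n) \<and> (\<forall>x. p x \<in> C)"
proof -
  have sub: "qvs.subspace (C \<inter> gr n)" for n
    using C subspace_homogeneous by (simp add: graded_subspace_def qvs.subspace_inter)
  obtain q where q: "\<And>n. qlinear (q n)" "\<And>n x. q n x \<in> C \<inter> gr n" "\<And>n x. x \<in> C \<inter> gr n \<Longrightarrow> q n x = x"
    using exists_projection[OF sub] by metis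
  define p where "p = (\<lambda>x. \<Sum>n | component gr n x \<noteq> 0. q n (component gr n x))"
  \<comment> \<open>The sum may run over any finite set containing the support, because each
    \<open>q n\<close> sends 0 to 0; linearity needs such a common set.\<close>
  have p: "p x = (\<Sum>n\<in>N. q n (component gr n x))"
    if "finite N" "\<And>n. n \<notin> N \<Longrightarrow> component gr n x = 0" for x N
    unfolding p_def using that
    by (intro sum.mono_neutral_left) (auto simp: qlinear_zero[OF q(1)])
  have "qlinear p"
    unfolding qlinear_iff
  proof (intro conjI allI)
    fix x y c
    let ?N = "{n. component gr n x \<noteq> 0} \<union> {n. component gr n y \<noteq> 0}"
    have fin: "finite ?N" by (simp add: finite_support)
    note simps = qlinear_add[OF qlinear_component] qlinear_scaleQ[OF qlinear_component]
      qlinear_add[OF q(1)] qlinear_scaleQ[OF q(1)]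
    show "p (x + y) = p x + p y"
      by (subst (1 2 3) p[OF fin]) (auto simp: simps sum.distrib)
    show "p (c *\<^sub>Q x) = c *\<^sub>Q p x"
      by (subst (1 2) p[OF fin]) (auto simp: simps qvs.scale_sum_right)
  qed
  moreover have "p x = x" if "x \<in> C" for x
  proof -
    have "q n (component gr n x) = component gr n x" for n
      using graded_subspace_component[OF C that] component_in by (intro q(3)) blast
    then have "p x = (\<Sum>n | component gr n x \<noteq> 0. component gr n x)" by (simp add: p_def)
    also have "\<dots> = x" by (rule component_sum) (simp_all add: finite_support)
    finally show ?thesis .
  qed
  moreover have "p x \<in> C" for x
    unfolding p_def using q(2) C by (intro qvs.subspace_sum) (auto simp: graded_subspace_def)
  moreover have "p x \<in> C \<inter> gr n" if "x \<in> gr n" for x n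
    using that by (subst p[of "{n}"]) (use q(2) in \<open>auto simp: component_homogeneous\<close>)
  ultimately show ?thesis by blast
qed

section \<open>Homogeneous functionals and double annihilators\<close>

lemma restrict_deg_in_dual_gr: "qlinear f \<Longrightarrow> restrict_deg gr f n \<in> dual_gr gr n"
  unfolding dual_gr_def restrict_deg_def
  by (intro CollectI conjI allI impI ballI qlinear_comp[OF _ qlinear_component])
    (simp_all add: component_homogeneous qlinear_zero[of f])

lemma dual_gr_component:
  assumes "f \<in> dual_gr gr n"
  shows "f (component gr m x) = (if m = n then f x else 0)"
proof (cases "m = n")
  case True
  have "f (component gr n x) = f x"
  proof (rule qlinear_eq_on_homogeneous[where f = "\<lambda>x. f (component gr n x)"])
    show lin: "qlinear f" by (rule dual_gr_qlinear[OF assms])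
    then show "qlinear (\<lambda>x. f (component gr n x))" by (rule qlinear_comp[OF _ qlinear_component])
    show "f (component gr n x) = f x" if "x \<in> gr m" for m x
      using assms that by (auto simp: component_homogeneous qlinear_zero[OF lin] dual_gr_def)
  qed
  then show ?thesis using True by simp
next
  case False
  then show ?thesis using assms component_in[of m x] unfolding dual_gr_def by simp
qed

text \<open>A homogeneous functional sees a single degree, so a finite combination sees only
  finitely many; \<open>N\<close> collects these degrees.\<close>

lemma graded_dual_decomposition:
  assumes "f \<in> graded_dual gr"
  shows "\<exists>N. finite N \<and> f = (\<Sum>n\<in>N. restrict_deg gr f n)"
proof -
  have "\<exists>N. finite N \<and> (\<forall>n x. n \<notin> N \<longrightarrow> f (component gr n x) = 0)"
    using assms unfolding graded_dual_def
  proof (induction rule: qvs.span_induct_alt)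
    case base
    show ?case by (intro exI[of _ "{}"]) simp
  next
    case (step c g h)
    then obtain N m where "finite N" "\<And>n x. n \<notin> N \<Longrightarrow> h (component gr n x) = 0"
      "g \<in> dual_gr gr m" by blast
    then show ?case
      by (intro exI[of _ "insert m N"]) (auto simp: scaleQ_fun_def dual_gr_component)
  qed
  then obtain N where N: "finite N" "\<And>n x. n \<notin> N \<Longrightarrow> f (component gr n x) = 0" by blast
  have eq: "f x = (\<Sum>n\<in>N. f (component gr n x))" for x
  proof -
    \<comment> \<open>\<open>N\<close> bounds the degrees seen by \<open>f\<close>, not those
      occurring in \<open>x\<close>; the sum is taken over both and then cut down to
      \<open>N\<close>.\<close>
    let ?M = "N \<union> {n. component gr n x \<noteq> 0}"
    have M: "finite ?M" using N(1) by (simp add: finite_support)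
    have "f x = f (\<Sum>n\<in>?M. component gr n x)"
      by (subst component_sum[OF M]) auto
    also have "\<dots> = (\<Sum>n\<in>?M. f (component gr n x))"
      by (rule qlinear_sum[OF graded_dual_qlinear[OF assms]])
    also have "\<dots> = (\<Sum>n\<in>N. f (component gr n x))"
      using M N(2) by (intro sum.mono_neutral_right) auto
    finally show ?thesis .
  qed
  have "(\<Sum>n\<in>N. restrict_deg gr f n) x = (\<Sum>n\<in>N. f (component gr n x))" for x
    by (induction N rule: infinite_finite_induct) (auto simp: restrict_deg_def)
  then have "f = (\<Sum>n\<in>N. restrict_deg gr f n)" using eq by (intro ext) metis
  then show ?thesis using N(1) by blast
qed

text \<open>A nonzero component is detected by some functional, and restricting that functional to
  the degree in question puts it into the graded dual.\<close>

lemma graded_dual_separates: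
  assumes "\<forall>f\<in>graded_dual gr. f x = 0"
  shows "x = 0"
proof -
  have "component gr n x = 0" for n
  proof (rule ccontr)
    assume "component gr n x \<noteq> 0"
    then obtain f :: "'a \<Rightarrow> rat" where f: "qlinear f" "f (component gr n x) \<noteq> 0"
      using exists_functional_nonzero by blast
    then have "restrict_deg gr f n x \<noteq> 0" by (simp add: restrict_deg_def)
    then show False
      using assms dual_gr_subset_graded_dual[OF restrict_deg_in_dual_gr[OF f(1)]] by blast
  qed
  then show ?thesis using component_sum[of "{}" x] by simp
qed

text \<open>Taking the degree \<open>n\<close> part is linear in the functional and sends each
  homogeneous generator of \<open>J\<close> to itself or to 0.\<close>

lemma graded_subspace_restrict_deg:
  assumes J: "graded_subspace (dual_gr gr) J" and f: "f \<in> J"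
  shows "restrict_deg gr f n \<in> J"
proof -
  have sub: "qvs.subspace J" and sp: "f \<in> qvs.span (\<Union>n. J \<inter> dual_gr gr n)"
    using assms by (auto simp: graded_subspace_def)
  show ?thesis unfolding restrict_deg_def
  proof (rule qlinear_span_into[OF qlinear_precompose sub _ sp])
    fix g assume "g \<in> (\<Union>n. J \<inter> dual_gr gr n)"
    then obtain m where g: "g \<in> J" "g \<in> dual_gr gr m" by blast
    have "(\<lambda>x. g (component gr n x)) = (if n = m then g else 0)"
      by (simp add: fun_eq_iff dual_gr_component[OF g(2)])
    then show "(\<lambda>x. g (component gr n x)) \<in> J"
      using g(1) qvs.subspace_0[OF sub] by simp
  qed
qed

lemma graded_subspace_annihilator:
  assumes J: "graded_subspace (dual_gr gr) J" "J \<subseteq> graded_dual gr"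
  shows "graded_subspace gr (annihilator J)"
proof (rule graded_subspaceI)
  have lin: "qlinear f" if "f \<in> J" for f using that J(2) graded_dual_qlinear by blast
  show "qvs.subspace (annihilator J)"
    by (rule qvs.subspaceI)
      (auto simp: annihilator_def qlinear_zero lin qlinear_add qlinear_scaleQ)
  show "component gr n x \<in> annihilator J" if "x \<in> annihilator J" for n x
    using that graded_subspace_restrict_deg[OF J(1)]
    by (auto simp: annihilator_def restrict_deg_def)
qed

text \<open>The coordinate functionals of \<open>gr n\<close>, precomposed with the projection to
  degree \<open>n\<close>, span the dual component.\<close>

lemma dual_gr_finite_dimensional:
  assumes "\<exists>B. finite B \<and> gr n = qvs.span B"
  shows "\<exists>T. finite T \<and> dual_gr gr n \<subseteq> qvs.span T"
proof -
  obtain B where B: "finite B" "gr n = qvs.span B" using assms by blast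
  obtain E and c :: "'a \<Rightarrow> 'a \<Rightarrow> rat" where E: "finite E" "\<And>e. qlinear (c e)"
    "\<And>x. x \<in> gr n \<Longrightarrow> x = (\<Sum>e\<in>E. c e x *\<^sub>Q e)"
    using exists_coordinates[OF B(1)] B(2) by metis
  let ?h = "\<lambda>e x. c e (component gr n x)"
  have "f \<in> qvs.span (?h ` E)" if f: "f \<in> dual_gr gr n" for f
  proof -
    have "f x = (\<Sum>e\<in>E. f e *\<^sub>Q ?h e) x" for x
    proof -
      have "f x = f (component gr n x)" by (simp add: dual_gr_component[OF f])
      also have "\<dots> = (\<Sum>e\<in>E. ?h e x * f e)"
        by (subst E(3)[OF component_in])
          (simp add: qlinear_sum[OF dual_gr_qlinear[OF f]] qlinear_scaleQ[OF dual_gr_qlinear[OF f]])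
      also have "\<dots> = (\<Sum>e\<in>E. f e *\<^sub>Q ?h e) x"
        using E(1) by (induction E) (auto simp: scaleQ_fun_def)
      finally show ?thesis .
    qed
    then have "f = (\<Sum>e\<in>E. f e *\<^sub>Q ?h e)" by (rule ext)
    moreover have "(\<Sum>e\<in>E. f e *\<^sub>Q ?h e) \<in> qvs.span (?h ` E)"
      by (intro qvs.span_sum qvs.span_scale qvs.span_base) auto
    ultimately show ?thesis by simp
  qed
  then show ?thesis using E(1) by (intro exI[of _ "?h ` E"]) auto
qed

text \<open>Double annihilator theorem, proved one degree at a time. Finite dimension gives a finite
  basis \<open>G\<close> of the degree \<open>n\<close> part of \<open>J\<close>, to which
  \<open>functional_in_span\<close> applies.\<close>

lemma in_of_vanish_on_annihilator:
  assumes fin: "\<And>n. \<exists>B. finite B \<and> gr n = qvs.span B"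
    and J: "graded_subspace (dual_gr gr) J" "J \<subseteq> graded_dual gr"
    and f: "f \<in> graded_dual gr" "\<And>x. x \<in> annihilator J \<Longrightarrow> f x = 0"
  shows "f \<in> J"
proof -
  have sub: "qvs.subspace J" using J(1) by (simp add: graded_subspace_def)
  note flin = graded_dual_qlinear[OF f(1)]
  have "restrict_deg gr f n \<in> J" for n
  proof -
    obtain G where G: "G \<subseteq> J \<inter> dual_gr gr n" "qvs.independent G" "J \<inter> dual_gr gr n \<subseteq> qvs.span G"
      by (rule qvs.maximal_independent_subset)
    obtain T where T: "finite T" "dual_gr gr n \<subseteq> qvs.span T"
      using dual_gr_finite_dimensional[OF fin] by blast
    have "finite G" using qvs.independent_span_bound[OF T(1) G(2)] G(1) T(2) by blast
    then have "restrict_deg gr f n \<in> qvs.span G"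
    proof (rule functional_in_span)
      show "\<forall>g\<in>G. qlinear g" using G(1) dual_gr_qlinear[of _ gr n] by blast
      show "qlinear (restrict_deg gr f n)"
        by (rule dual_gr_qlinear[OF restrict_deg_in_dual_gr[OF flin]])
      fix x assume x: "\<forall>g\<in>G. g x = 0"
      \<comment> \<open>On this component a functional \<open>g\<close> from \<open>J\<close> acts
        through its degree \<open>n\<close> part, which lies in \<open>J\<close> by gradedness,
        hence in the span of \<open>G\<close>, and so vanishes at \<open>x\<close>.\<close>
      have "component gr n x \<in> annihilator J"
        unfolding annihilator_def
      proof (intro CollectI ballI)
        fix g assume g: "g \<in> J"
        then have "qlinear g" using J(2) graded_dual_qlinear[of g gr] by blast
        then have "restrict_deg gr g n \<in> J \<inter> dual_gr gr n"
          using graded_subspace_restrict_deg[OF J(1) g] restrict_deg_in_dual_gr[of g n] by blast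
        then have "restrict_deg gr g n \<in> qvs.span G" using G(3) by blast
        then have "restrict_deg gr g n x = 0"
          by (rule qlinear_span_zero[where F = "\<lambda>g. g x", rotated 2])
            (use x in \<open>auto simp: qlinear_iff scaleQ_fun_def\<close>)
        then show "g (component gr n x) = 0" by (simp add: restrict_deg_def)
      qed
      then show "restrict_deg gr f n x = 0" using f(2) by (simp add: restrict_deg_def)
    qed
    moreover have "qvs.span G \<subseteq> J" using G(1) sub by (intro qvs.span_minimal) auto
    ultimately show ?thesis by blast
  qed
  then have "(\<Sum>n\<in>N. restrict_deg gr f n) \<in> J" for N by (intro qvs.subspace_sum[OF sub])
  then show ?thesis using graded_dual_decomposition[OF f(1)] by metis
qed

end


section \<open>Ideals of the graded dual and their annihilators\<close>

text \<open>The first hypothesis puts \<open>A\<close> itself among the ideals being intersected, so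
  the intersection stays inside \<open>A\<close>.\<close>

lemma two_sided_ideal_generated:
  assumes "two_sided_ideal A m A" "X \<subseteq> A"
  shows "two_sided_ideal A m (ideal_generated A m X)"
  unfolding two_sided_ideal_def
proof (intro conjI ballI)
  show "ideal_generated A m X \<subseteq> A"
    unfolding ideal_generated_def using assms by blast
  show "qvs.subspace (ideal_generated A m X)"
    unfolding ideal_generated_def by (rule qvs.subspace_Inter) (auto simp: two_sided_ideal_def)
qed (auto simp: ideal_generated_def two_sided_ideal_def)

lemma ideal_generated_superset: "X \<subseteq> ideal_generated A m X"
  by (auto simp: ideal_generated_def)

lemma ideal_generated_subset: "two_sided_ideal A m J \<Longrightarrow> X \<subseteq> J \<Longrightarrow> ideal_generated A m X \<subseteq> J"
  by (auto simp: ideal_generated_def)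

lemma dual_mult_apply: "dual_mult \<Delta> f g x = tensor_functional f g (\<Delta> x)"
  by (simp add: dual_mult_def tensor_functional_def)

text \<open>Bilinear counterpart of \<open>qlinear_span_into\<close>. Additivity of
  \<open>dual_mult\<close> is available only on linear functionals, since \<open>tensor_lift\<close>
  has the dummy value 0 off bilinear maps; hence linearity is carried along in the auxiliary
  subspaces.\<close>

lemma dual_mult_span_into:
  assumes X: "X \<subseteq> {f. qlinear f}" and Y: "Y \<subseteq> {f. qlinear f}" and U: "qvs.subspace U"
    and XY: "\<And>f g. f \<in> X \<Longrightarrow> g \<in> Y \<Longrightarrow> dual_mult \<Delta> f g \<in> U"
    and f: "f \<in> qvs.span X" and g: "g \<in> qvs.span Y"
  shows "dual_mult \<Delta> f g \<in> U"
proof -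
  have add: "dual_mult \<Delta> (f + f') g = dual_mult \<Delta> f g + dual_mult \<Delta> f' g"
    and add': "dual_mult \<Delta> g (f + f') = dual_mult \<Delta> g f + dual_mult \<Delta> g f'"
    if "qlinear f" "qlinear f'" "qlinear g" for f f' g :: "'a \<Rightarrow> rat"
    using tensor_lift_fun_add[OF qbilinear_functionals[OF that(1,3)] qbilinear_functionals[OF that(2,3)]]
      tensor_lift_fun_add[OF qbilinear_functionals[OF that(3,1)] qbilinear_functionals[OF that(3,2)]]
    by (simp_all add: dual_mult_def fun_eq_iff distrib_left distrib_right)
  have scale: "dual_mult \<Delta> (c *\<^sub>Q f) g = c *\<^sub>Q dual_mult \<Delta> f g"
    and scale': "dual_mult \<Delta> g (c *\<^sub>Q f) = c *\<^sub>Q dual_mult \<Delta> g f"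
    if "qlinear f" "qlinear g" for c and f g :: "'a \<Rightarrow> rat"
    using tensor_lift_fun_scaleQ[OF qbilinear_functionals[OF that], of c]
      tensor_lift_fun_scaleQ[OF qbilinear_functionals[OF that(2,1)], of c]
    by (simp_all add: dual_mult_def fun_eq_iff scaleQ_fun_def mult.assoc mult.left_commute)
  have zero: "dual_mult \<Delta> 0 g = 0" "dual_mult \<Delta> g 0 = 0" if "qlinear g" for g
    using scale[OF that that, of 0] scale'[OF that that, of 0] by simp_all
  note L = qvs.subspace_0[OF subspace_qlinear] qvs.subspace_add[OF subspace_qlinear]
    qvs.subspace_scale[OF subspace_qlinear]
  note U' = qvs.subspace_0[OF U] qvs.subspace_add[OF U] qvs.subspace_scale[OF U]
  have 1: "dual_mult \<Delta> f g \<in> U" if g: "g \<in> Y" for g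
  proof -
    have lin: "qlinear g" using Y g by blast
    have "qvs.subspace {f. qlinear f \<and> dual_mult \<Delta> f g \<in> U}"
    proof (rule qvs.subspaceI)
      show "0 \<in> {f. qlinear f \<and> dual_mult \<Delta> f g \<in> U}"
        using L(1) U'(1) zero(1)[OF lin] by auto
      show "c *\<^sub>Q f \<in> {f. qlinear f \<and> dual_mult \<Delta> f g \<in> U}"
        if "f \<in> {f. qlinear f \<and> dual_mult \<Delta> f g \<in> U}" for c f
        using that L(3)[of f c] U'(3)[of _ c] scale[OF _ lin, of f c] by auto
      show "f + f' \<in> {f. qlinear f \<and> dual_mult \<Delta> f g \<in> U}"
        if "f \<in> {f. qlinear f \<and> dual_mult \<Delta> f g \<in> U}"
          "f' \<in> {f. qlinear f \<and> dual_mult \<Delta> f g \<in> U}" for f f'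
        using that L(2)[of f f'] U'(2) add[OF _ _ lin, of f f'] by auto
    qed
    then have "qvs.span X \<subseteq> {f. qlinear f \<and> dual_mult \<Delta> f g \<in> U}"
      using X XY g by (intro qvs.span_minimal) auto
    then show ?thesis using f by blast
  qed
  have lin: "qlinear f" using X f qvs.span_minimal[OF X subspace_qlinear] by blast
  have "qvs.subspace {g. qlinear g \<and> dual_mult \<Delta> f g \<in> U}"
  proof (rule qvs.subspaceI)
    show "0 \<in> {g. qlinear g \<and> dual_mult \<Delta> f g \<in> U}"
      using L(1) U'(1) zero(2)[OF lin] by auto
    show "c *\<^sub>Q g \<in> {g. qlinear g \<and> dual_mult \<Delta> f g \<in> U}"
      if "g \<in> {g. qlinear g \<and> dual_mult \<Delta> f g \<in> U}" for c g
      using that L(3)[of g c] U'(3)[of _ c] scale'[OF _ lin, of g c] by auto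
    show "g + g' \<in> {g. qlinear g \<and> dual_mult \<Delta> f g \<in> U}"
      if "g \<in> {g. qlinear g \<and> dual_mult \<Delta> f g \<in> U}"
        "g' \<in> {g. qlinear g \<and> dual_mult \<Delta> f g \<in> U}" for g g'
      using that L(2)[of g g'] U'(2) add'[OF _ _ lin, of g g'] by auto
  qed
  then have "qvs.span Y \<subseteq> {g. qlinear g \<and> dual_mult \<Delta> f g \<in> U}"
    using Y 1 by (intro qvs.span_minimal) auto
  then show ?thesis using g by blast
qed

lemma finite_degrees_le: "finite {i :: 'l::finite \<Rightarrow> nat. \<exists>j. i + j = n}"
proof (rule finite_subset)
  show "{i. \<exists>j. i + j = n} \<subseteq> PiE UNIV (\<lambda>l. {..n l})" by (auto simp: PiE_def)
  show "finite (PiE UNIV (\<lambda>l. {..n l}))" by (rule finite_PiE) auto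
qed

section \<open>Convolution product and graded ideals\<close>

context graded_connected_hopf_algebra
begin

sublocale graded_vector_space gr
  by unfold_locales (rule subspace_gr, rule direct_sum)

lemma dual_mult_qlinear: "qlinear (dual_mult comult f g)"
  unfolding dual_mult_def by (rule qlinear_comp[OF qlinear_tensor_lift linear_comult])

text \<open>The coproduct of an element of degree \<open>d\<close> has terms only in bidegrees
  \<open>(i, j)\<close> with \<open>i + j = d\<close>. If \<open>d \<noteq> m + n\<close>, one of
  the two functionals kills its factor.\<close>

lemma dual_mult_dual_gr:
  assumes f: "f \<in> dual_gr gr m" and g: "g \<in> dual_gr gr n"
  shows "dual_mult comult f g \<in> dual_gr gr (m + n)"
  unfolding dual_gr_def
proof (intro CollectI conjI allI impI ballI dual_mult_qlinear)
  fix d x assume d: "d \<noteq> m + n" and x: "x \<in> gr d"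
  have "tensor_functional f g (comult x) = 0"
  proof (rule qlinear_span_zero[OF qlinear_tensor_functional _ comult_gr[OF x]])
    fix t assume "t \<in> (\<Union>(i, j)\<in>{(i, j). i + j = d}. tensor_span (gr i) (gr j))"
    then obtain i j where ij: "i + j = d" "t \<in> tensor_span (gr i) (gr j)" by blast
    have "tensor_functional f g t \<in> {0}"
    proof (rule tensor_span_into[OF qlinear_tensor_functional qvs.subspace_single_0 _ ij(2)])
      fix a b assume ab: "a \<in> gr i" "b \<in> gr j"
      have "i \<noteq> m \<or> j \<noteq> n" using d ij(1) by auto
      then have "f a * g b = 0" using f g ab by (auto simp: dual_gr_def)
      then show "tensor_functional f g (a \<otimes> b) \<in> {0}"
        by (simp add: tensor_functional_tens[OF dual_gr_qlinear[OF f] dual_gr_qlinear[OF g]])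
    qed
    then show "tensor_functional f g t = 0" by simp
  qed
  then show "dual_mult comult f g x = 0" by (simp add: dual_mult_apply)
qed

lemma dual_mult_closed:
  assumes "f \<in> graded_dual gr" "g \<in> graded_dual gr"
  shows "dual_mult comult f g \<in> graded_dual gr"
proof (rule dual_mult_span_into[OF _ _ subspace_graded_dual])
  show "f \<in> qvs.span (\<Union>n. dual_gr gr n)" "g \<in> qvs.span (\<Union>n. dual_gr gr n)"
    using assms by (simp_all add: graded_dual_def)
  show "dual_mult comult f g \<in> graded_dual gr"
    if "f \<in> (\<Union>n. dual_gr gr n)" "g \<in> (\<Union>n. dual_gr gr n)" for f g
    using that by (auto intro: dual_gr_subset_graded_dual dual_mult_dual_gr)
qed (auto simp: dual_gr_def)

lemma two_sided_ideal_graded_dual: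
  "two_sided_ideal (graded_dual gr) (dual_mult comult) (graded_dual gr)"
  by (simp add: two_sided_ideal_def subspace_graded_dual dual_mult_closed)

text \<open>Multiplying by homogeneous functionals preserves homogeneity, so the span of the
  homogeneous members of the generated ideal is again an ideal. It contains \<open>X\<close>, and
  minimality gives equality.\<close>

lemma graded_ideal_generated:
  assumes X: "X \<subseteq> (\<Union>n. dual_gr gr n)"
  shows "graded_subspace (dual_gr gr) (ideal_generated (graded_dual gr) (dual_mult comult) X)"
proof -
  let ?I = "ideal_generated (graded_dual gr) (dual_mult comult) X"
  let ?H = "\<Union>n. ?I \<inter> dual_gr gr n"
  have "X \<subseteq> graded_dual gr" using X dual_gr_subset_graded_dual[of _ gr] by blast
  then have I: "two_sided_ideal (graded_dual gr) (dual_mult comult) ?I"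
    by (rule two_sided_ideal_generated[OF two_sided_ideal_graded_dual])
  then have sub: "qvs.subspace ?I" by (simp add: two_sided_ideal_def)
  have HI: "qvs.span ?H \<subseteq> ?I" using sub by (intro qvs.span_minimal) auto
  have lin: "(\<Union>n. dual_gr gr n) \<subseteq> {f. qlinear f}" "?H \<subseteq> {f. qlinear f}"
    by (auto simp: dual_gr_def)
  have "two_sided_ideal (graded_dual gr) (dual_mult comult) (qvs.span ?H)"
    unfolding two_sided_ideal_def
  proof (intro conjI ballI)
    show "qvs.span ?H \<subseteq> graded_dual gr" using HI I by (auto simp: two_sided_ideal_def)
    show "qvs.subspace (qvs.span ?H)" by simp
    fix a f assume a: "a \<in> graded_dual gr" and f: "f \<in> qvs.span ?H"
    have H: "dual_mult comult u v \<in> qvs.span ?H \<and> dual_mult comult v u \<in> qvs.span ?H"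
      if uv: "u \<in> (\<Union>n. dual_gr gr n)" "v \<in> ?H" for u v
    proof -
      obtain m n where u: "u \<in> dual_gr gr m" and v: "v \<in> ?I" "v \<in> dual_gr gr n"
        using uv by blast
      have "dual_mult comult u v \<in> ?I" "dual_mult comult v u \<in> ?I"
        using I v(1) dual_gr_subset_graded_dual[OF u] by (auto simp: two_sided_ideal_def)
      then have "dual_mult comult u v \<in> ?H" "dual_mult comult v u \<in> ?H"
        using dual_mult_dual_gr[OF u v(2)] dual_mult_dual_gr[OF v(2) u] by blast+
      then show ?thesis by (simp add: qvs.span_base)
    qed
    show "dual_mult comult a f \<in> qvs.span ?H"
      using H by (intro dual_mult_span_into[OF lin qvs.subspace_span _ a[unfolded graded_dual_def] f])
        blast
    show "dual_mult comult f a \<in> qvs.span ?H"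
      using H by (intro dual_mult_span_into[OF lin(2,1) qvs.subspace_span _ f a[unfolded graded_dual_def]])
        blast
  qed
  moreover have "X \<subseteq> qvs.span ?H"
    using X ideal_generated_superset[of X "graded_dual gr" "dual_mult comult"]
    by (blast intro: qvs.span_base)
  ultimately have "?I \<subseteq> qvs.span ?H" by (rule ideal_generated_subset)
  then show ?thesis using HI sub by (simp add: graded_subspace_def subset_antisym)
qed

text \<open>For \<open>f\<close> in the graded dual, the difference of \<open>f\<close> and its
  composite with \<open>p\<close> vanishes on the annihilator, hence lies in \<open>J\<close>. By
  telescoping, pairing \<open>f\<close> and \<open>g\<close> with the difference of the two sides
  evaluates two products from \<open>J\<close> at \<open>x\<close>, giving 0.\<close>

lemma annihilator_comult_projection:
  assumes J: "two_sided_ideal (graded_dual gr) (dual_mult comult) J" "graded_subspace (dual_gr gr) J"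
    and p: "qlinear p" "\<And>x. x \<in> annihilator J \<Longrightarrow> p x = x"
      "\<And>n x. x \<in> gr n \<Longrightarrow> p x \<in> gr n"
    and x: "x \<in> annihilator J"
  shows "tensor_map p p (comult x) = comult x"
proof -
  have JD: "J \<subseteq> graded_dual gr" using J(1) by (simp add: two_sided_ideal_def)
  have inJ: "(\<lambda>x. f x - f (p x)) \<in> J" and pD: "(\<lambda>x. f (p x)) \<in> graded_dual gr"
    if f: "f \<in> graded_dual gr" for f
  proof -
    show pD: "(\<lambda>x. f (p x)) \<in> graded_dual gr" by (rule graded_dual_precompose[OF p(1,3) f])
    have "f - (\<lambda>x. f (p x)) \<in> graded_dual gr"
      by (rule qvs.subspace_diff[OF subspace_graded_dual f pD])
    then have "(\<lambda>x. f x - f (p x)) \<in> graded_dual gr" by (simp add: fun_diff_def)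
    then show "(\<lambda>x. f x - f (p x)) \<in> J"
      by (rule in_of_vanish_on_annihilator[OF finite_dim_gr J(2) JD]) (simp add: p(2))
  qed
  have "comult x - tensor_map p p (comult x) = 0"
  proof (rule tensor_separation[where P = "graded_dual gr" and Q = "graded_dual gr"])
    fix f g assume f: "f \<in> graded_dual gr" and g: "g \<in> graded_dual gr"
    note lin = graded_dual_qlinear[OF f] graded_dual_qlinear[OF g]
    have "tensor_functional f g (comult x - tensor_map p p (comult x)) =
      tensor_functional f g (comult x) - tensor_functional (\<lambda>x. f (p x)) (\<lambda>x. g (p x)) (comult x)"
      by (simp add: qlinear_diff[OF qlinear_tensor_functional] tensor_functional_map[OF lin p(1) p(1)])
    also have "\<dots> = dual_mult comult (\<lambda>x. f x - f (p x)) g x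
        + dual_mult comult (\<lambda>x. f (p x)) (\<lambda>x. g x - g (p x)) x"
      unfolding dual_mult_apply by (rule tensor_functional_diff[OF lin qlinear_comp[OF lin(1) p(1)]
            qlinear_comp[OF lin(2) p(1)]])
    also have "\<dots> = 0"
    proof -
      have "dual_mult comult (\<lambda>x. f x - f (p x)) g \<in> J"
        "dual_mult comult (\<lambda>x. f (p x)) (\<lambda>x. g x - g (p x)) \<in> J"
        using J(1) inJ[OF f] inJ[OF g] pD[OF f] g by (auto simp: two_sided_ideal_def)
      then show ?thesis using x unfolding annihilator_def by (metis (mono_tags, lifting) add_0 mem_Collect_eq)
    qed
    finally show "tensor_functional f g (comult x - tensor_map p p (comult x)) = 0" .
  qed (use graded_dual_qlinear graded_dual_separates in blast)+
  then show ?thesis by simp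
qed

text \<open>A graded projection onto the annihilator fixes \<open>comult x\<close> and sends every
  elementary tensor into the tensor square. The second form also records degrees, for the recursion
  that computes the antipode.\<close>

lemma annihilator_comult:
  assumes J: "two_sided_ideal (graded_dual gr) (dual_mult comult) J" "graded_subspace (dual_gr gr) J"
    and x: "x \<in> annihilator J"
  shows "comult x \<in> tensor_span (annihilator J) (annihilator J)" (is ?tens)
    and "x \<in> gr n \<Longrightarrow> comult x \<in> qvs.span (\<Union>(i, j)\<in>{(i, j). i + j = n}.
      tensor_span (annihilator J \<inter> gr i) (annihilator J \<inter> gr j))"
proof -
  let ?C = "annihilator J"
  have C: "graded_subspace gr ?C"
    using J by (intro graded_subspace_annihilator) (auto simp: two_sided_ideal_def)
  obtain p where p: "qlinear p" "\<And>x. x \<in> ?C \<Longrightarrow> p x = x" "\<And>n x. x \<in> gr n \<Longrightarrow> p x \<in> ?C \<inter> gr n"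
    and pC: "\<And>x. p x \<in> ?C"
    using graded_projection_exists[OF C] by blast
  have eq: "tensor_map p p (comult x) = comult x"
    using p(3) by (intro annihilator_comult_projection[OF J p(1,2) _ x]) auto
  have "tensor_map p p t \<in> tensor_span ?C ?C" for t
    by (induction t rule: tensor_induct)
      (auto simp: tensor_map_tens p(1) qlinear_add[OF qlinear_tensor_map]
        qlinear_scaleQ[OF qlinear_tensor_map] pC tens_in_tensor_span
        qvs.subspace_add[OF subspace_tensor_span] qvs.subspace_scale[OF subspace_tensor_span])
  then show ?tens using eq by metis
  assume "x \<in> gr n"
  let ?U = "qvs.span (\<Union>(i, j)\<in>{(i, j). i + j = n}. tensor_span (?C \<inter> gr i) (?C \<inter> gr j))"
  have "tensor_map p p (comult x) \<in> ?U"
  proof (rule qlinear_span_into[OF qlinear_tensor_map qvs.subspace_span _ comult_gr[OF \<open>x \<in> gr n\<close>]])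
    fix t assume "t \<in> (\<Union>(i, j)\<in>{(i, j). i + j = n}. tensor_span (gr i) (gr j))"
    then obtain i j where ij: "i + j = n" "t \<in> tensor_span (gr i) (gr j)" by blast
    show "tensor_map p p t \<in> ?U"
    proof (rule tensor_span_into[OF qlinear_tensor_map qvs.subspace_span _ ij(2)])
      fix a b assume "a \<in> gr i" "b \<in> gr j"
      then have "p a \<otimes> p b \<in> tensor_span (?C \<inter> gr i) (?C \<inter> gr j)"
        using p(3) by (intro tens_in_tensor_span) auto
      then show "tensor_map p p (a \<otimes> b) \<in> ?U"
        using ij(1) by (auto simp: tensor_map_tens p(1) intro!: qvs.span_base)
    qed
  qed
  then show "comult x \<in> ?U" by (simp add: eq)
qed

section \<open>The coproduct of the graded dual\<close>

text \<open>For \<open>f\<close> of degree \<open>n\<close>, expand the left argument of the product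
  in coordinates of each \<open>gr i\<close> with \<open>i \<le> n\<close>; finite-dimensional
  components make this a finite sum of elementary tensors.\<close>

lemma dual_comult_exists:
  assumes "f \<in> graded_dual gr"
  shows "\<exists>t \<in> tensor_span (graded_dual gr) (graded_dual gr).
    \<forall>a b. tensor_lift (\<lambda>u v. u a * v b) t = f (a * b)"
proof -
  have "f \<in> qvs.span (\<Union>n. dual_gr gr n)" using assms by (simp add: graded_dual_def)
  then show ?thesis
  proof (induction rule: qvs.span_induct_alt)
    case base
    show ?case
      by (rule bexI[of _ 0])
        (simp_all add: qlinear_zero[OF qlinear_tensor_lift] qvs.subspace_0[OF subspace_tensor_span])
  next
    case (step c f g)
    let ?T = "tensor_span (graded_dual gr) (graded_dual gr)"
    obtain s where s: "s \<in> ?T" "\<And>a b. tensor_lift (\<lambda>u v. u a * v b) s = g (a * b)"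
      using step(2) by blast
    obtain n where f: "f \<in> dual_gr gr n" using step(1) by blast
    note flin = dual_gr_qlinear[OF f]
    let ?N = "{i. \<exists>j. i + j = n}"
    define Q where "Q = (\<lambda>i E (c :: 'h \<Rightarrow> 'h \<Rightarrow> rat). finite E \<and> E \<subseteq> gr i \<and> (\<forall>e. qlinear (c e)) \<and>
      (\<forall>x\<in>gr i. x = (\<Sum>e\<in>E. c e x *\<^sub>Q e)))"
    have "\<exists>E c. Q i E c" for i
    proof -
      obtain B where B: "finite B" "gr i = qvs.span B" using finite_dim_gr[of i] by blast
      show ?thesis unfolding Q_def B(2) by (rule exists_coordinates[OF B(1)])
    qed
    then obtain E e where Q: "\<And>i. Q i (E i) (e i)" by metis
    have E: "\<And>i. finite (E i)" "\<And>i. E i \<subseteq> gr i" "\<And>i x. qlinear (e i x)"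
        "\<And>i x. x \<in> gr i \<Longrightarrow> x = (\<Sum>y\<in>E i. e i y x *\<^sub>Q y)"
      using Q unfolding Q_def by blast+
    \<comment> \<open>The first factor is the coordinate functional at \<open>y\<close>, cut to
      degree \<open>i\<close>; the second is \<open>f\<close> after left multiplication by
      \<open>y\<close>, which has degree \<open>j\<close> with \<open>i + j = n\<close>.\<close>
    define t where "t = (\<Sum>i\<in>?N. \<Sum>y\<in>E i. restrict_deg gr (e i y) i \<otimes> (\<lambda>b. f (y * b)))"
    have mlin: "qlinear (\<lambda>b. f (y * b))" "qlinear (\<lambda>a. f (a * b))" for y b
      by (simp_all add: qlinear_iff distrib_left distrib_right mult_scaleQ_left mult_scaleQ_right
          qlinear_add[OF flin] qlinear_scaleQ[OF flin])
    have "t \<in> ?T" unfolding t_def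
    proof (intro qvs.subspace_sum[OF subspace_tensor_span] tens_in_tensor_span)
      fix i y assume "i \<in> ?N" and y: "y \<in> E i"
      then obtain j where j: "i + j = n" by blast
      show "restrict_deg gr (e i y) i \<in> graded_dual gr"
        by (rule dual_gr_subset_graded_dual[OF restrict_deg_in_dual_gr[OF E(3)]])
      have "f (y * b) = 0" if "m \<noteq> j" "b \<in> gr m" for m b
      proof -
        have "i + m \<noteq> n" using j that(1) by auto
        moreover have "y * b \<in> gr (i + m)" using E(2) y that(2) by (intro mult_gr) auto
        ultimately show ?thesis using f by (auto simp: dual_gr_def)
      qed
      then have "(\<lambda>b. f (y * b)) \<in> dual_gr gr j" using mlin(1) by (auto simp: dual_gr_def)
      then show "(\<lambda>b. f (y * b)) \<in> graded_dual gr" by (rule dual_gr_subset_graded_dual)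
    qed
    moreover have "tensor_lift (\<lambda>u v. u a * v b) t = f (a * b)" for a b
    proof -
      \<comment> \<open>Components of \<open>a\<close> whose degree is not below \<open>n\<close>
        contribute nothing, so the sum may be enlarged to cover the support of
        \<open>a\<close>.\<close>
      have 0: "f (component gr i a * b) = 0" if "i \<notin> ?N" for i
      proof (rule qlinear_eq_on_homogeneous[OF mlin(1), where g = "\<lambda>_. 0"])
        fix m b assume "b \<in> gr m"
        then have "component gr i a * b \<in> gr (i + m)" by (rule mult_gr[OF component_in])
        then show "f (component gr i a * b) = 0" using that f by (auto simp: dual_gr_def)
      qed (simp add: qlinear_iff)
      let ?M = "?N \<union> {i. component gr i a \<noteq> 0}"
      have M: "finite ?M" by (simp add: finite_support finite_degrees_le)
      have "tensor_lift (\<lambda>u v. u a * v b) t =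
          (\<Sum>i\<in>?N. \<Sum>y\<in>E i. e i y (component gr i a) * f (y * b))"
        by (simp add: t_def qlinear_sum[OF qlinear_tensor_lift] tensor_lift_pairing restrict_deg_def)
      also have "\<dots> = (\<Sum>i\<in>?N. f (component gr i a * b))"
      proof (rule sum.cong[OF refl])
        fix i
        have "f (component gr i a * b) = f ((\<Sum>y\<in>E i. e i y (component gr i a) *\<^sub>Q y) * b)"
          using E(4)[OF component_in] by metis
        also have "\<dots> = (\<Sum>y\<in>E i. e i y (component gr i a) * f (y * b))"
          by (simp add: qlinear_sum[OF mlin(2)] qlinear_scaleQ[OF mlin(2)])
        finally show "(\<Sum>y\<in>E i. e i y (component gr i a) * f (y * b)) = f (component gr i a * b)"
          by simp
      qed
      also have "\<dots> = (\<Sum>i\<in>?M. f (component gr i a * b))"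
        using M 0 by (intro sum.mono_neutral_left) auto
      also have "\<dots> = f ((\<Sum>i\<in>?M. component gr i a) * b)"
        by (rule qlinear_sum[OF mlin(2), symmetric])
      also have "\<dots> = f (a * b)" by (subst component_sum[OF M]) auto
      finally show ?thesis .
    qed
    ultimately show ?case using s
      by (intro bexI[of _ "c *\<^sub>Q t + s"])
        (auto simp: qlinear_add[OF qlinear_tensor_lift] qlinear_scaleQ[OF qlinear_tensor_lift]
          scaleQ_fun_def qvs.subspace_add[OF subspace_tensor_span]
          qvs.subspace_scale[OF subspace_tensor_span])
  qed
qed

lemma dual_comult:
  assumes "f \<in> graded_dual gr"
  shows "dual_comult gr f \<in> tensor_span (graded_dual gr) (graded_dual gr)"
    and "tensor_lift (\<lambda>u v. u a * v b) (dual_comult gr f) = f (a * b)"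
proof -
  let ?P = "\<lambda>t. t \<in> tensor_span (graded_dual gr) (graded_dual gr) \<and>
    (\<forall>a b. tensor_lift (\<lambda>u v. u a * v b) t = f (a * b))"
  obtain t where t: "?P t" using dual_comult_exists[OF assms] by blast
  have "s = t" if "?P s" for s
  proof -
    have "s - t = 0"
      using that t by (intro tensor_eval_eq_zero) (simp add: qlinear_diff[OF qlinear_tensor_lift])
    then show ?thesis by simp
  qed
  then have "?P (dual_comult gr f)" unfolding dual_comult_def using t by (rule theI[rotated])
  then show "dual_comult gr f \<in> tensor_span (graded_dual gr) (graded_dual gr)"
    "tensor_lift (\<lambda>u v. u a * v b) (dual_comult gr f) = f (a * b)" by blast+
qed

text \<open>Let \<open>P\<close> be the transpose of a graded projection \<open>p\<close> onto the
  annihilator. Applying \<open>P\<close> to both factors of the coproduct of \<open>f\<close> gives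
  0, as its value at \<open>a\<close>, \<open>b\<close> is \<open>f (p a * p b)\<close>. The
  coproduct thus equals its difference with this image, and telescoping puts the difference into the
  required span.\<close>

lemma dual_comult_coideal:
  assumes J: "graded_subspace (dual_gr gr) J" "J \<subseteq> graded_dual gr"
    and mult: "\<And>x y. x \<in> annihilator J \<Longrightarrow> y \<in> annihilator J \<Longrightarrow> x * y \<in> annihilator J"
    and f: "f \<in> J"
  shows "dual_comult gr f \<in> qvs.span (tensor_span J (graded_dual gr) \<union> tensor_span (graded_dual gr) J)"
    (is "_ \<in> ?U")
proof -
  let ?C = "annihilator J" and ?D = "graded_dual gr"
  have fD: "f \<in> ?D" using J(2) f by blast
  obtain p where p: "qlinear p" "\<And>x. x \<in> ?C \<Longrightarrow> p x = x" "\<And>n x. x \<in> gr n \<Longrightarrow> p x \<in> ?C \<inter> gr n"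
    and pC: "\<And>x. p x \<in> ?C"
    using graded_projection_exists[OF graded_subspace_annihilator[OF J]] by blast
  define P where "P = (\<lambda>(u :: 'h \<Rightarrow> rat) x. u (p x))"
  have P: "qlinear P" unfolding P_def by (rule qlinear_precompose)
  have PD: "P u \<in> ?D" if "u \<in> ?D" for u
    unfolding P_def by (rule graded_dual_precompose[OF p(1) _ that]) (use p(3) in blast)
  have PJ: "u - P u \<in> J" if "u \<in> ?D" for u
    using qvs.subspace_diff[OF subspace_graded_dual that PD[OF that]]
    by (rule in_of_vanish_on_annihilator[OF finite_dim_gr J]) (simp add: P_def p(2))
  have "tensor_map P P (dual_comult gr f) = 0"
  proof (rule tensor_eval_eq_zero)
    fix a b
    have "tensor_lift (\<lambda>u v. u a * v b) (tensor_map P P t) = tensor_lift (\<lambda>u v. u (p a) * v (p b)) t" for t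
      by (rule qlinear_tensor_eqI[OF qlinear_comp[OF qlinear_tensor_lift qlinear_tensor_map] qlinear_tensor_lift])
        (simp add: tensor_map_tens P tensor_lift_pairing, simp add: P_def)
    then have "tensor_lift (\<lambda>u v. u a * v b) (tensor_map P P (dual_comult gr f)) = f (p a * p b)"
      by (simp add: dual_comult(2)[OF fD])
    then show "tensor_lift (\<lambda>u v. u a * v b) (tensor_map P P (dual_comult gr f)) = 0"
      using mult[OF pC pC] f by (simp add: annihilator_def)
  qed
  moreover have "dual_comult gr f - tensor_map P P (dual_comult gr f) \<in> ?U"
  proof (rule tensor_span_into[OF qlinear_fun_diff[OF qlinear_id qlinear_tensor_map] qvs.subspace_span _
        dual_comult(1)[OF fD]])
    fix u v assume uv: "u \<in> ?D" "v \<in> ?D"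
    have "u \<otimes> v - tensor_map P P (u \<otimes> v) = (u - P u) \<otimes> v + P u \<otimes> (v - P v)"
      by (simp add: tensor_map_tens P tens_diff_left tens_diff_right)
    also have "\<dots> \<in> ?U"
    proof (rule qvs.span_add)
      show "(u - P u) \<otimes> v \<in> ?U" using uv by (intro qvs.span_base UnI1 tens_in_tensor_span PJ)
      show "P u \<otimes> (v - P v) \<in> ?U" using uv by (intro qvs.span_base UnI2 tens_in_tensor_span PJ PD)
    qed
    finally show "u \<otimes> v - tensor_map P P (u \<otimes> v) \<in> ?U" .
  qed
  ultimately show ?thesis by simp
qed

section \<open>Equalizing subcoalgebras\<close>

lemma counit_degree_zero: "b \<in> gr 0 \<Longrightarrow> counit b *\<^sub>Q 1 = b"
proof -
  assume "b \<in> gr 0"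
  then have "b - counit b *\<^sub>Q 1 = 0"
    unfolding connected
    by (rule qlinear_span_zero[where F = "\<lambda>b. b - counit b *\<^sub>Q 1", rotated 2])
      (auto simp: qlinear_iff qlinear_add[OF linear_counit] qlinear_scaleQ[OF linear_counit]
        scaleQ_add_left qvs.scale_right_diff_distrib counit_one)
  then show ?thesis by simp
qed

text \<open>Induction on the total degree. The coproduct hypothesis records degrees and membership
  in \<open>C\<close> together, because the recursion applies to left factors that must lie in
  \<open>C\<close> and have smaller degree.\<close>

lemma antipode_closed:
  assumes C: "graded_subspace gr C" "1 \<in> C" "\<And>x y. x \<in> C \<Longrightarrow> y \<in> C \<Longrightarrow> x * y \<in> C"
    and comult: "\<And>n x. x \<in> C \<Longrightarrow> x \<in> gr n \<Longrightarrow>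
      comult x \<in> qvs.span (\<Union>(i, j)\<in>{(i, j). i + j = n}. tensor_span (C \<inter> gr i) (C \<inter> gr j))"
    and x: "x \<in> C"
  shows "antipode x \<in> C"
proof -
  have sub: "qvs.subspace C" and sp: "x \<in> qvs.span (\<Union>n. C \<inter> gr n)"
    using C(1) x by (auto simp: graded_subspace_def)
  note lin = qlinear_add[OF linear_antipode] qlinear_scaleQ[OF linear_antipode]
    qlinear_add[OF linear_counit] qlinear_scaleQ[OF linear_counit]
  \<comment> \<open>Pairing with \<open>b - counit b\<close> kills the term of \<open>\<Delta> y\<close> in which \<open>a\<close> has full degree, so
    \<open>antipode y\<close> is expressed through antipodes of elements of lower degree.\<close>
  let ?B = "\<lambda>a b. antipode a * (b - counit b *\<^sub>Q 1)"
  have B: "qbilinear ?B" "qbilinear (\<lambda>a b. antipode a * b)" "qbilinear (\<lambda>(a::'h) b. counit b *\<^sub>Q a)"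
    by (simp_all add: qbilinear_iff lin distrib_left distrib_right right_diff_distrib
        mult_scaleQ_left mult_scaleQ_right scaleQ_add_left scaleQ_add_right scaleQ_scaleQ
        qvs.scale_right_diff_distrib mult.commute)
  \<comment> \<open>Both sides are linear in \<open>t\<close>. At \<open>t = comult y\<close> the
    antipode and counit axioms turn the right side into
    \<open>counit y *\<^sub>Q 1 - antipode y\<close>.\<close>
  have "tensor_lift ?B t = tensor_lift (\<lambda>a b. antipode a * b) t
      - antipode (tensor_lift (\<lambda>a b. counit b *\<^sub>Q a) t)" for t
    by (rule qlinear_tensor_eqI[OF qlinear_tensor_lift qlinear_fun_diff[OF qlinear_tensor_lift
            qlinear_comp[OF linear_antipode qlinear_tensor_lift]]])
      (simp only: tensor_lift_tens[OF B(1)] tensor_lift_tens[OF B(2)] tensor_lift_tens[OF B(3)],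
        simp add: lin right_diff_distrib mult_scaleQ_right)
  then have rec: "antipode y = counit y *\<^sub>Q 1 - tensor_lift ?B (comult y)" for y
    by (simp add: antipode_left counit_right)
  have hom: "antipode y \<in> C" if "y \<in> C" "y \<in> gr n" for n y
    using that
  proof (induction "\<Sum>l\<in>UNIV. n l" arbitrary: n y rule: less_induct)
    case less
    have "tensor_lift ?B (comult y) \<in> C"
    proof (rule qlinear_span_into[OF qlinear_tensor_lift sub _ comult[OF less.prems]])
      fix t assume "t \<in> (\<Union>(i, j)\<in>{(i, j). i + j = n}. tensor_span (C \<inter> gr i) (C \<inter> gr j))"
      then obtain i j where ij: "i + j = n" "t \<in> tensor_span (C \<inter> gr i) (C \<inter> gr j)" by blast
      show "tensor_lift ?B t \<in> C"
      proof (rule tensor_span_into[OF qlinear_tensor_lift sub _ ij(2)])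
        fix a b assume a: "a \<in> C \<inter> gr i" and b: "b \<in> C \<inter> gr j"
        have "?B a b \<in> C"
        proof (cases "j = 0")
          case True
          then show ?thesis using b counit_degree_zero[of b] qvs.subspace_0[OF sub] by simp
        next
          case False
          then obtain l where "j l \<noteq> 0" by (auto simp: fun_eq_iff)
          \<comment> \<open>A nonzero \<open>j\<close> makes \<open>i\<close> smaller than
            \<open>n\<close> in some coordinate and larger in none, so the total degree
            drops.\<close>
          then have "i l < n l" "\<And>l. i l \<le> n l" using ij(1) by auto
          then have "(\<Sum>l\<in>UNIV. i l) < (\<Sum>l\<in>UNIV. n l)"
            by (intro sum_strict_mono_ex1) auto
          then have "antipode a \<in> C" using less.hyps a by blast
          moreover have "b - counit b *\<^sub>Q 1 \<in> C"
            using b C(2) by (intro qvs.subspace_diff[OF sub] qvs.subspace_scale[OF sub]) auto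
          ultimately show ?thesis by (rule C(3))
        qed
        then show "tensor_lift ?B (a \<otimes> b) \<in> C" by (simp only: tensor_lift_tens[OF B(1)])
      qed
    qed
    then show ?case
      unfolding rec[of y]
      by (intro qvs.subspace_diff[OF sub] qvs.subspace_scale[OF sub] C(2))
  qed
  show ?thesis
    using hom by (intro qlinear_span_into[OF linear_antipode sub _ sp]) blast
qed

text \<open>A graded subspace contains the components of its elements, and members of the span have
  no component outside the admissible degrees. The componentwise form is linear in \<open>x\<close>,
  so it can be checked on generators.\<close>

lemma equalizing_subcoalgebra_iff:
  assumes "qlinear \<phi>" "qlinear \<psi>"
  shows "equalizing_subcoalgebra gr comult k \<phi> \<psi> C \<longleftrightarrow>
    graded_subspace gr C \<and> subcoalgebra comult C \<and>
    (\<forall>n. deg_le n k \<longrightarrow> (\<forall>x\<in>C. \<phi> (component gr n x) = \<psi> (component gr n x)))"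
proof -
  have "(\<forall>h \<in> C \<inter> qvs.span (\<Union>n\<in>{n. deg_le n k}. gr n). \<phi> h = \<psi> h) \<longleftrightarrow>
      (\<forall>n. deg_le n k \<longrightarrow> (\<forall>x\<in>C. \<phi> (component gr n x) = \<psi> (component gr n x)))"
    if C: "graded_subspace gr C"
  proof (intro iffI allI impI ballI)
    fix n x assume *: "\<forall>h \<in> C \<inter> qvs.span (\<Union>n\<in>{n. deg_le n k}. gr n). \<phi> h = \<psi> h"
      "deg_le n k" "x \<in> C"
    have "component gr n x \<in> qvs.span (\<Union>n\<in>{n. deg_le n k}. gr n)"
      using *(2) component_in by (intro qvs.span_base) blast
    then show "\<phi> (component gr n x) = \<psi> (component gr n x)"
      using *(1) graded_subspace_component[OF C *(3)] by blast
  next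
    fix h
    assume *: "\<forall>n. deg_le n k \<longrightarrow> (\<forall>x\<in>C. \<phi> (component gr n x) = \<psi> (component gr n x))"
      and h: "h \<in> C \<inter> qvs.span (\<Union>n\<in>{n. deg_le n k}. gr n)"
    have 0: "component gr n h = 0" if n: "\<not> deg_le n k" for n
    proof (rule qlinear_span_zero[OF qlinear_component])
      show "h \<in> qvs.span (\<Union>n\<in>{n. deg_le n k}. gr n)" using h by blast
      show "component gr n x = 0" if "x \<in> (\<Union>n\<in>{n. deg_le n k}. gr n)" for x
        using that n by (auto simp: component_homogeneous)
    qed
    have eq: "\<phi> (component gr n h) = \<psi> (component gr n h)" for n
      using * h 0[of n] qlinear_zero[OF assms(1)] qlinear_zero[OF assms(2)]
      by (cases "deg_le n k") auto
    have sum: "f h = (\<Sum>n | component gr n h \<noteq> 0. f (component gr n h))"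
      if "qlinear f" for f :: "'h \<Rightarrow> rat"
      by (subst qlinear_sum[OF that, symmetric], subst component_sum) (simp_all add: finite_support)
    show "\<phi> h = \<psi> h" unfolding sum[OF assms(1)] sum[OF assms(2)] by (simp add: eq)
  qed
  then show ?thesis unfolding equalizing_subcoalgebra_def by blast
qed

section \<open>The ideal of two characters and its annihilator\<close>

context
  fixes \<phi> \<psi> :: "'h \<Rightarrow> rat" and k :: "'l \<Rightarrow> enat"
  assumes char: "character \<phi>" "character \<psi>"
begin

private lemma char_qlinear: "qlinear \<phi>" "qlinear \<psi>"
  using char by (auto simp: character_def)

private abbreviation (input) "I \<equiv> I_ideal gr comult k \<phi> \<psi>"

private lemma generators_homogeneous:
  "{restrict_deg gr \<phi> n - restrict_deg gr \<psi> n | n. deg_le n k} \<subseteq> (\<Union>n. dual_gr gr n)"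
  using qvs.subspace_diff[OF subspace_dual_gr restrict_deg_in_dual_gr[OF char_qlinear(1)]
      restrict_deg_in_dual_gr[OF char_qlinear(2)]] by blast

lemma I_ideal_two_sided: "two_sided_ideal (graded_dual gr) (dual_mult comult) I"
  unfolding I_ideal_def
  by (rule two_sided_ideal_generated[OF two_sided_ideal_graded_dual])
    (use generators_homogeneous dual_gr_subset_graded_dual[of _ gr] in blast)

lemma I_ideal_graded: "graded_subspace (dual_gr gr) I"
  unfolding I_ideal_def by (rule graded_ideal_generated[OF generators_homogeneous])

lemma I_ideal_subset: "I \<subseteq> graded_dual gr"
  using I_ideal_two_sided by (simp add: two_sided_ideal_def)

lemma annihilator_equalizing: "equalizing_subcoalgebra gr comult k \<phi> \<psi> (annihilator I)"
  unfolding equalizing_subcoalgebra_iff[OF char_qlinear]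
proof (intro conjI allI impI ballI)
  show gC: "graded_subspace gr (annihilator I)"
    by (rule graded_subspace_annihilator[OF I_ideal_graded I_ideal_subset])
  then show "subcoalgebra comult (annihilator I)"
    using annihilator_comult(1)[OF I_ideal_two_sided I_ideal_graded]
    by (simp add: subcoalgebra_def graded_subspace_def)
  fix n x assume n: "deg_le n k" and x: "x \<in> annihilator I"
  have "restrict_deg gr \<phi> n - restrict_deg gr \<psi> n \<in> I"
    unfolding I_ideal_def by (rule subsetD[OF ideal_generated_superset]) (use n in blast)
  then have "(restrict_deg gr \<phi> n - restrict_deg gr \<psi> n) x = 0"
    using x by (simp only: annihilator_def mem_Collect_eq)
  then show "\<phi> (component gr n x) = \<psi> (component gr n x)" by (simp add: restrict_deg_def)
qed

lemma equalizing_subset_annihilator: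
  assumes "equalizing_subcoalgebra gr comult k \<phi> \<psi> E"
  shows "E \<subseteq> annihilator I"
proof -
  have E: "subcoalgebra comult E"
    "\<And>n x. deg_le n k \<Longrightarrow> x \<in> E \<Longrightarrow> \<phi> (component gr n x) = \<psi> (component gr n x)"
    using assms by (simp_all add: equalizing_subcoalgebra_iff[OF char_qlinear])
  \<comment> \<open>The annihilator of \<open>E\<close> in the graded dual. It is an ideal because a
    factor killing \<open>E\<close> makes the product vanish on
    \<open>tensor_span E E\<close>.\<close>
  let ?J = "{f \<in> graded_dual gr. \<forall>x\<in>E. f x = 0}"
  have mult: "tensor_functional f g (comult x) = 0"
    if "qlinear f" "qlinear g" "x \<in> E" "\<And>a b. a \<in> E \<Longrightarrow> b \<in> E \<Longrightarrow> f a * g b = 0" for f g x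
  proof -
    have "tensor_functional f g (comult x) \<in> {0}"
    proof (rule tensor_span_into[OF qlinear_tensor_functional qvs.subspace_single_0])
      show "comult x \<in> tensor_span E E" using E(1) that(3) by (simp add: subcoalgebra_def)
      show "tensor_functional f g (a \<otimes> b) \<in> {0}" if ab: "a \<in> E" "b \<in> E" for a b
        using \<open>\<And>a b. a \<in> E \<Longrightarrow> b \<in> E \<Longrightarrow> f a * g b = 0\<close>[OF ab]
        by (simp add: tensor_functional_tens[OF \<open>qlinear f\<close> \<open>qlinear g\<close>])
    qed
    then show ?thesis by simp
  qed
  have "two_sided_ideal (graded_dual gr) (dual_mult comult) ?J"
    unfolding two_sided_ideal_def
  proof (intro conjI ballI)
    show "qvs.subspace ?J"
      unfolding Collect_conj_eq Collect_mem_eq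
      by (rule qvs.subspace_inter[OF subspace_graded_dual], rule qvs.subspaceI)
        (auto simp: scaleQ_fun_def)
    fix a f assume a: "a \<in> graded_dual gr" and f: "f \<in> ?J"
    then have fD: "f \<in> graded_dual gr" by blast
    note lin = graded_dual_qlinear[OF a] graded_dual_qlinear[OF fD]
    show "dual_mult comult a f \<in> ?J" "dual_mult comult f a \<in> ?J"
      using f dual_mult_closed[OF a fD] dual_mult_closed[OF fD a] mult[OF lin] mult[OF lin(2,1)]
      by (auto simp: dual_mult_apply)
  qed auto
  moreover have "{restrict_deg gr \<phi> n - restrict_deg gr \<psi> n | n. deg_le n k} \<subseteq> ?J"
  proof (intro subsetI)
    fix f assume f: "f \<in> {restrict_deg gr \<phi> n - restrict_deg gr \<psi> n | n. deg_le n k}"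
    then have "f \<in> graded_dual gr"
      using generators_homogeneous dual_gr_subset_graded_dual[of f gr] by blast
    moreover have "\<forall>x\<in>E. f x = 0" using f E(2) by (auto simp: restrict_deg_def)
    ultimately show "f \<in> ?J" by blast
  qed
  ultimately have "I \<subseteq> ?J" unfolding I_ideal_def by (rule ideal_generated_subset)
  then show ?thesis by (auto simp: annihilator_def)
qed

text \<open>The annihilator is an equalizing subcoalgebra containing every other one, so the
  greatest one exists and \<open>GREATEST\<close> denotes it.\<close>

lemma S_sub_eq_annihilator: "S_sub gr comult k \<phi> \<psi> = annihilator I"
  unfolding S_sub_def
  by (rule Greatest_equality, rule annihilator_equalizing, erule equalizing_subset_annihilator)

lemma one_in_annihilator: "1 \<in> annihilator I"
proof -
  have one: "1 \<in> gr 0" unfolding connected by (simp add: qvs.span_base)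
  have "equalizing_subcoalgebra gr comult k \<phi> \<psi> (qvs.span {1})"
    unfolding equalizing_subcoalgebra_iff[OF char_qlinear] subcoalgebra_def
  proof (intro conjI allI impI ballI)
    show "graded_subspace gr (qvs.span {1})" using one by (intro graded_subspace_span) blast
    show "qvs.subspace (qvs.span {1})" by simp
    fix x :: 'h assume x: "x \<in> qvs.span {1}"
    show "comult x \<in> tensor_span (qvs.span {1}) (qvs.span {1})"
      by (rule qlinear_span_into[OF linear_comult subspace_tensor_span _ x])
        (auto simp: comult_one intro!: tens_in_tensor_span qvs.span_base)
    fix n
    have "(\<lambda>x. \<phi> (component gr n x) - \<psi> (component gr n x)) x = 0"
    proof (rule qlinear_span_zero[OF _ _ x])
      show "qlinear (\<lambda>x. \<phi> (component gr n x) - \<psi> (component gr n x))"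
        by (intro qlinear_fun_diff qlinear_comp[OF _ qlinear_component] char_qlinear)
      \<comment> \<open>In degree 0 both characters take the value 1 at the unit; in every other
        degree the component is 0.\<close>
      show "\<phi> (component gr n x) - \<psi> (component gr n x) = 0" if "x \<in> {1}" for x
        using that char component_homogeneous[OF one, of n]
        by (simp add: character_def qlinear_zero[OF char_qlinear(1)] qlinear_zero[OF char_qlinear(2)])
    qed
    then show "\<phi> (component gr n x) = \<psi> (component gr n x)" by simp
  qed
  then show ?thesis using equalizing_subset_annihilator by (auto intro: qvs.span_base)
qed

lemma mult_in_annihilator:
  assumes "x \<in> annihilator I" "y \<in> annihilator I"
  shows "x * y \<in> annihilator I"
proof -
  let ?C = "annihilator I"
  \<comment> \<open>Products of homogeneous elements only: this makes the span graded and reduces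
    the comparison of the characters to homogeneous factors.\<close>
  define X where "X = {a * b | a b i j. a \<in> ?C \<inter> gr i \<and> b \<in> ?C \<inter> gr j}"
  have C: "graded_subspace gr ?C" "subcoalgebra comult ?C"
    "\<And>n x. deg_le n k \<Longrightarrow> x \<in> ?C \<Longrightarrow> \<phi> (component gr n x) = \<psi> (component gr n x)"
    using annihilator_equalizing by (simp_all add: equalizing_subcoalgebra_iff[OF char_qlinear])
  have CX: "a * b \<in> qvs.span X" if a: "a \<in> ?C" and b: "b \<in> ?C" for a b
  proof -
    have sp: "a \<in> qvs.span (\<Union>n. ?C \<inter> gr n)" "b \<in> qvs.span (\<Union>n. ?C \<inter> gr n)"
      using a b C(1) by (auto simp: graded_subspace_def)
    show ?thesis
    proof (rule qlinear_span_into[where F = "\<lambda>a. a * b", OF _ qvs.subspace_span _ sp(1)])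
      show "qlinear (\<lambda>a. a * b)" by (simp add: qlinear_iff distrib_right mult_scaleQ_left)
      fix a assume a: "a \<in> (\<Union>n. ?C \<inter> gr n)"
      show "a * b \<in> qvs.span X"
      proof (rule qlinear_span_into[where F = "\<lambda>b. a * b", OF _ qvs.subspace_span _ sp(2)])
        show "qlinear (\<lambda>b. a * b)" by (simp add: qlinear_iff distrib_left mult_scaleQ_right)
        show "a * b \<in> qvs.span X" if "b \<in> (\<Union>n. ?C \<inter> gr n)" for b
          using a that unfolding X_def by (intro qvs.span_base) blast
      qed
    qed
  qed
  have "equalizing_subcoalgebra gr comult k \<phi> \<psi> (qvs.span X)"
    unfolding equalizing_subcoalgebra_iff[OF char_qlinear] subcoalgebra_def
  proof (intro conjI allI impI ballI)
    show "graded_subspace gr (qvs.span X)"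
      unfolding X_def by (rule graded_subspace_span) (blast intro: mult_gr)
    show "qvs.subspace (qvs.span X)" by simp
    fix x assume x: "x \<in> qvs.span X"
    show "comult x \<in> tensor_span (qvs.span X) (qvs.span X)"
    proof (rule qlinear_span_into[OF linear_comult subspace_tensor_span _ x])
      fix x assume "x \<in> X"
      then obtain a b where ab: "x = a * b" "a \<in> ?C" "b \<in> ?C" by (auto simp: X_def)
      show "comult x \<in> tensor_span (qvs.span X) (qvs.span X)"
        unfolding ab(1) comult_mult
        using ab(2,3) C(2) by (intro tensor_mult_in_tensor_span[OF _ _ CX])
          (auto simp: subcoalgebra_def)
    qed
    fix n assume n: "deg_le n k"
    have "(\<lambda>x. \<phi> (component gr n x) - \<psi> (component gr n x)) x = 0"
    proof (rule qlinear_span_zero[OF _ _ x])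
      show "qlinear (\<lambda>x. \<phi> (component gr n x) - \<psi> (component gr n x))"
        by (intro qlinear_fun_diff qlinear_comp[OF _ qlinear_component] char_qlinear)
      fix x assume "x \<in> X"
      then obtain a b i j where ab: "x = a * b" "a \<in> ?C" "a \<in> gr i" "b \<in> ?C" "b \<in> gr j"
        by (auto simp: X_def)
      have c: "component gr n x = (if n = i + j then a * b else 0)"
        using component_homogeneous[OF mult_gr[OF ab(3,5)]] by (simp add: ab(1))
      show "\<phi> (component gr n x) - \<psi> (component gr n x) = 0"
      proof (cases "n = i + j")
        case True
        \<comment> \<open>The admissible degrees are closed downwards, so both factors are in range
          whenever their product is; multiplicativity then transfers the equality.\<close>
        have "deg_le i k" "deg_le j k"
          using n unfolding True deg_le_def le_fun_def
          by (auto intro: order_trans[rotated])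
        then have "\<phi> a = \<psi> a" "\<phi> b = \<psi> b"
          using C(3)[of i a] C(3)[of j b] ab by (simp_all add: component_homogeneous)
        moreover have "component gr n x = a * b" using c True by simp
        ultimately show ?thesis using char by (simp add: character_def)
      next
        case False
        then show ?thesis
          by (simp add: c qlinear_zero[OF char_qlinear(1)] qlinear_zero[OF char_qlinear(2)])
      qed
    qed
    then show "\<phi> (component gr n x) = \<psi> (component gr n x)" by simp
  qed
  then have "qvs.span X \<subseteq> ?C" by (rule equalizing_subset_annihilator)
  then show ?thesis using CX[OF assms] by blast
qed

lemma antipode_in_annihilator: "x \<in> annihilator I \<Longrightarrow> antipode x \<in> annihilator I"
  by (rule antipode_closed[OF graded_subspace_annihilator[OF I_ideal_graded I_ideal_subset]
        one_in_annihilator mult_in_annihilator annihilator_comult(2)[OF I_ideal_two_sided I_ideal_graded]])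

lemma annihilator_hopf_subalgebra: "graded_hopf_subalgebra gr comult antipode (annihilator I)"
  using annihilator_equalizing one_in_annihilator mult_in_annihilator antipode_in_annihilator
  by (simp add: graded_hopf_subalgebra_def equalizing_subcoalgebra_def)

text \<open>The coideal, counit and antipode conditions are dual to closure of the annihilator under
  products, its containing 1, and its stability under the antipode. For the antipode, the double
  annihilator leads back to \<open>I\<close>.\<close>

lemma I_ideal_hopf_ideal: "graded_hopf_ideal_of_dual gr comult antipode I"
  unfolding graded_hopf_ideal_of_dual_def hopf_ideal_def
proof (intro conjI ballI I_ideal_graded I_ideal_two_sided)
  fix f assume f: "f \<in> I"
  show "dual_comult gr f \<in> qvs.span (tensor_span I (graded_dual gr) \<union> tensor_span (graded_dual gr) I)"
    by (rule dual_comult_coideal[OF I_ideal_graded I_ideal_subset mult_in_annihilator f])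
  show "dual_counit f = 0"
    using one_in_annihilator f by (simp add: dual_counit_def annihilator_def)
  show "dual_antipode antipode f \<in> I"
    unfolding dual_antipode_def
  proof (rule in_of_vanish_on_annihilator[OF finite_dim_gr I_ideal_graded I_ideal_subset])
    show "(\<lambda>x. f (antipode x)) \<in> graded_dual gr"
      by (rule graded_dual_precompose[OF linear_antipode antipode_gr subsetD[OF I_ideal_subset f]])
    show "f (antipode x) = 0" if "x \<in> annihilator I" for x
      using antipode_in_annihilator[OF that] f by (simp add: annihilator_def)
  qed
qed

end

end

theorem theorem4p1:
  fixes comult :: "'h::rat_algebra_1 \<Rightarrow> ('h, 'h) tensor"
    and counit :: "'h \<Rightarrow> rat"
    and antipode :: "'h \<Rightarrow> 'h"
    and gr :: "('l::finite \<Rightarrow> nat) \<Rightarrow> 'h set"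
    and \<phi> \<psi> :: "'h \<Rightarrow> rat"
    and k :: "'l \<Rightarrow> enat"
  assumes "graded_connected_hopf_algebra comult counit antipode gr"
    and "character \<phi>" and "character \<psi>"
  shows "S_sub gr comult k \<phi> \<psi> = annihilator (I_ideal gr comult k \<phi> \<psi>) \<and>
    graded_hopf_ideal_of_dual gr comult antipode (I_ideal gr comult k \<phi> \<psi>) \<and>
    graded_hopf_subalgebra gr comult antipode (S_sub gr comult k \<phi> \<psi>)"
proof -
  interpret graded_connected_hopf_algebra comult counit antipode gr by fact
  show ?thesis
    using S_sub_eq_annihilator[OF assms(2,3)] I_ideal_hopf_ideal[OF assms(2,3)]
      annihilator_hopf_subalgebra[OF assms(2,3)] by simp
qed

end
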